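(* Let $\mathcal{L}$ be a (possibly unbounded) self-adjoint operator on a Hilbert space $\mathcal{H}$ with domain $\mathcal{D}(\mathcal{L})$. Let $\{\mathcal{P}_n:\mathcal{H}\rightarrow \mathcal{V}_n\}_{n\in\mathbb{N}}$ be a sequence of orthogonal projections onto Hilbert spaces (closed subspaces) $\mathcal{V}_n\subset \mathcal{H}$ such that $\mathcal{V}_n\subset\mathcal{D}(\mathcal{L})$ for every $n$ and $\mathcal{P}_n^*\mathcal{P}_n$ converges strongly to the identity, i.e. $\lim_{n\to\infty}\|\mathcal{P}_n^*\mathcal{P}_nu-u\|=0$ for all $u\in\mathcal{H}$. Suppose in addition that there exists a core $S\subset\mathcal{D}(\mathcal{L})$ of $\mathcal{L}$ such that $$\lim_{n\rightarrow\infty}\mathcal{L}\mathcal{P}_n^*\mathcal{P}_nu=\mathcal{L}u,\qquad \lim_{n\rightarrow\infty}\mathcal{P}_n^*\mathcal{P}_nu=u\qquad \text{for all } u\in S.$$ Then, for any $v\in\mathcal{H}$ and any bounded continuous function $f$ on $\mathbb{R}$, $$\lim_{n\rightarrow\infty}\int_{\mathbb{R}} f(\lambda) \,\mathrm{d} \mu_{v,n}(\lambda)=\int_{\mathbb{R}} f(\lambda) \,\mathrm{d} \mu_{v}(\lambda),$$ where $\mu_v$ is the scalar-valued spectral measure of $\mathcal{L}$ with respect to $v$, and $\mu_{v,n}$ is the scalar-valued spectral measure of $\mathcal{P}_n\mathcal{L}\mathcal{P}_n^*$ with respect to the vector $v_n=\mathcal{P}_nv\in\mathcal{V}_n$.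
   Context: The orthogonal projection $\mathcal{P}_n$ is regarded as a map from $\mathcal{H}$ onto $\mathcal{V}_n$, so its adjoint $\mathcal{P}_n^*:\mathcal{V}_n\to\mathcal{H}$ is the inclusion; $\mathcal{P}_n^*\mathcal{P}_n$ is the usual orthogonal projection on $\mathcal{H}$ with range $\mathcal{V}_n$. The operator $\mathcal{P}_n\mathcal{L}\mathcal{P}_n^*$ is the self-adjoint compression of $\mathcal{L}$ acting on the Hilbert space $\mathcal{V}_n$. A core of $\mathcal{L}$ is a linear subspace $S\subset\mathcal{D}(\mathcal{L})$ such that for every $u\in\mathcal{D}(\mathcal{L})$ there is a sequence $\{u_m\}\subset S$ with $u_m\to u$ and $\mathcal{L}u_m\to\mathcal{L}u$. For a self-adjoint operator $T$ on a Hilbert space with projection-valued spectral measure $\mathcal{E}_T$ and a vector $w$ in that space, the scalar-valued spectral measure of $T$ with respect to $w$ is the finite Borel measure on $\mathbb{R}$ given by $B\mapsto\langle \mathcal{E}_T(B)w,w\rangle$, for Borel sets $B\subset\mathbb{R}$. *)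

theory Defs
  imports "HOL-Analysis.Analysis"
begin

section \<open>Complex Hilbert spaces\<close>

text \<open>
  Norm, topology and completeness are those of the underlying real inner product space, whose
  inner product is the real part of the complex one.  The complex inner product is linear in its
  first argument.
\<close>

class complex_vector = real_vector +
  fixes scaleC :: "complex \<Rightarrow> 'a \<Rightarrow> 'a" (infixr "*\<^sub>C" 75)
  assumes scaleC_add_right: "c *\<^sub>C (x + y) = c *\<^sub>C x + c *\<^sub>C y"
    and scaleC_add_left: "(c + d) *\<^sub>C x = c *\<^sub>C x + d *\<^sub>C x"
    and scaleC_scaleC: "c *\<^sub>C d *\<^sub>C x = (c * d) *\<^sub>C x"
    and scaleC_of_real: "complex_of_real r *\<^sub>C x = r *\<^sub>R x"

class complex_inner = complex_vector + real_inner +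
  fixes cinner :: "'a \<Rightarrow> 'a \<Rightarrow> complex"
  assumes cinner_add_left: "cinner (x + y) z = cinner x z + cinner y z"
    and cinner_scaleC_left: "cinner (c *\<^sub>C x) y = c * cinner x y"
    and cinner_commute: "cinner x y = cnj (cinner y x)"
    and Re_cinner: "Re (cinner x y) = inner x y"

class chilbert_space = complex_inner + complete_space

definition csubspace :: "'a::complex_vector set \<Rightarrow> bool" where
  "csubspace S \<longleftrightarrow> subspace S \<and> (\<forall>c. \<forall>x\<in>S. c *\<^sub>C x \<in> S)"

definition clinear_on :: "'a::complex_vector set \<Rightarrow> ('a \<Rightarrow> 'b::complex_vector) \<Rightarrow> bool" where
  "clinear_on D T \<longleftrightarrow>
     (\<forall>x\<in>D. \<forall>y\<in>D. T (x + y) = T x + T y) \<and> (\<forall>c. \<forall>x\<in>D. T (c *\<^sub>C x) = c *\<^sub>C T x)"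

section \<open>Operators in closed subspaces\<close>

text \<open>
  A Hilbert space \<open>X\<close> below is a closed subspace of the type \<open>'a\<close>; the case \<open>X = UNIV\<close> is the
  ambient space.  This allows for operators acting on each of a sequence of subspaces.  An
  operator in \<open>X\<close> is given by its domain \<open>D \<subseteq> X\<close> and a function whose values outside \<open>D\<close> are
  irrelevant.
\<close>

definition closed_csubspace :: "'a::chilbert_space set \<Rightarrow> bool" where
  "closed_csubspace X \<longleftrightarrow> csubspace X \<and> closed X"

definition orthogonal_projection ::
    "'a::chilbert_space set \<Rightarrow> 'a set \<Rightarrow> ('a \<Rightarrow> 'a) \<Rightarrow> bool" where
  "orthogonal_projection X W Q \<longleftrightarrow>
     closed_csubspace W \<and> W \<subseteq> X \<and>
     (\<forall>x\<in>X. Q x \<in> W \<and> (\<forall>w\<in>W. cinner (x - Q x) w = 0))"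

definition operator_graph :: "'a set \<Rightarrow> ('a \<Rightarrow> 'a) \<Rightarrow> ('a \<times> 'a) set" where
  "operator_graph D T = {(x, T x) | x. x \<in> D}"

definition adjoint_graph ::
    "'a::chilbert_space set \<Rightarrow> 'a set \<Rightarrow> ('a \<Rightarrow> 'a) \<Rightarrow> ('a \<times> 'a) set" where
  "adjoint_graph X D T = {(y, z). y \<in> X \<and> z \<in> X \<and> (\<forall>x\<in>D. cinner (T x) y = cinner x z)}"

definition self_adjoint_operator ::
    "'a::chilbert_space set \<Rightarrow> 'a set \<Rightarrow> ('a \<Rightarrow> 'a) \<Rightarrow> bool" where
  "self_adjoint_operator X D T \<longleftrightarrow>
     closed_csubspace X \<and> csubspace D \<and> D \<subseteq> X \<and> X \<subseteq> closure D \<and>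
     clinear_on D T \<and> T ` D \<subseteq> X \<and> adjoint_graph X D T = operator_graph D T"

definition is_core ::
    "'a::chilbert_space set \<Rightarrow> ('a \<Rightarrow> 'a) \<Rightarrow> 'a set \<Rightarrow> bool" where
  "is_core D T S \<longleftrightarrow> csubspace S \<and> S \<subseteq> D \<and>
     (\<forall>u\<in>D. \<exists>s::nat \<Rightarrow> 'a. (\<forall>m. s m \<in> S) \<and> s \<longlonglongrightarrow> u \<and> (\<lambda>m. T (s m)) \<longlonglongrightarrow> T u)"

text \<open>
  With \<open>Q\<close> the orthogonal projection onto a closed subspace of the domain of \<open>T\<close>, this is
  \<open>Q T Q\<^sup>*\<close> as an operator on that subspace: the adjoint of \<open>Q\<close>, viewed as a map onto its range,
  is the inclusion.
\<close>

definition compression :: "('a \<Rightarrow> 'a) \<Rightarrow> ('a \<Rightarrow> 'a) \<Rightarrow> 'a \<Rightarrow> 'a" where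
  "compression Q T = (\<lambda>x. Q (T x))"

section \<open>Spectral measures\<close>

definition projection_valued_measure ::
    "'a::chilbert_space set \<Rightarrow> (real set \<Rightarrow> 'a \<Rightarrow> 'a) \<Rightarrow> bool" where
  "projection_valued_measure X E \<longleftrightarrow>
     (\<forall>B\<in>sets borel. \<exists>W. orthogonal_projection X W (E B)) \<and>
     (\<forall>x\<in>X. E {} x = 0) \<and> (\<forall>x\<in>X. E UNIV x = x) \<and>
     (\<forall>A\<in>sets borel. \<forall>B\<in>sets borel. \<forall>x\<in>X. E (A \<inter> B) x = E A (E B x)) \<and>
     (\<forall>A::nat \<Rightarrow> real set. range A \<subseteq> sets borel \<longrightarrow> disjoint_family A \<longrightarrow>
        (\<forall>x\<in>X. (\<lambda>n. E (A n) x) sums E (\<Union>n. A n) x))"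

definition scalar_spectral_measure ::
    "(real set \<Rightarrow> 'a \<Rightarrow> 'a) \<Rightarrow> 'a::chilbert_space \<Rightarrow> real measure" where
  "scalar_spectral_measure E w = measure_of UNIV (sets borel) (\<lambda>B. ennreal (Re (cinner (E B w) w)))"

text \<open>
  \<open>E\<close> is the projection-valued spectral measure of \<open>T\<close>, i.e. \<open>T = \<integral> \<lambda> dE(\<lambda>)\<close>: the domain of \<open>T\<close>
  consists of the vectors whose scalar measure has a finite second moment, and \<open>T\<close> is there
  determined (by polarization) by its quadratic form, which is the first moment.  For self-adjoint
  \<open>T\<close> there is exactly one such \<open>E\<close> on the Borel sets and on \<open>X\<close>, by the spectral theorem.
\<close>

definition is_spectral_measure ::
    "'a::chilbert_space set \<Rightarrow> 'a set \<Rightarrow> ('a \<Rightarrow> 'a) \<Rightarrow> (real set \<Rightarrow> 'a \<Rightarrow> 'a) \<Rightarrow> bool" where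
  "is_spectral_measure X D T E \<longleftrightarrow>
     projection_valued_measure X E \<and>
     D = {x \<in> X. integrable (scalar_spectral_measure E x) (\<lambda>t. t\<^sup>2)} \<and>
     (\<forall>x\<in>D. cinner (T x) x = complex_of_real (\<integral>t. t \<partial>scalar_spectral_measure E x))"

lemma cinner_projection_self:
  assumes "orthogonal_projection X W Q" "x \<in> X"
  shows "cinner (Q x) x = complex_of_real ((norm (Q x))\<^sup>2)"
proof -
  have "cinner (x - Q x) (Q x) = 0"
    using assms by (auto simp: orthogonal_projection_def)
  moreover have "cinner x (Q x) = cinner (x - Q x) (Q x) + cinner (Q x) (Q x)"
    using cinner_add_left[of "x - Q x" "Q x" "Q x"] by simp
  ultimately have eq: "cinner (Q x) x = cnj (cinner (Q x) (Q x))"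
    by (metis add.left_neutral cinner_commute)
  have "Im (cinner (Q x) (Q x)) = 0"
    using arg_cong[OF cinner_commute[of "Q x" "Q x"], of Im] by simp
  moreover have "Re (cinner (Q x) (Q x)) = (norm (Q x))\<^sup>2"
    by (simp add: Re_cinner power2_norm_eq_inner)
  ultimately show ?thesis
    by (simp add: eq complex_eq_iff)
qed

lemma sets_scalar_spectral_measure [simp]:
  "sets (scalar_spectral_measure E w) = sets borel"
  using sets.sigma_sets_eq[of "borel :: real measure"]
  by (simp add: scalar_spectral_measure_def)

text \<open>The totalization built into \<open>measure_of\<close> is not in play:\<close>

lemma emeasure_scalar_spectral_measure:
  assumes E: "projection_valued_measure X E" and w: "w \<in> X" and B: "B \<in> sets borel"
  shows "emeasure (scalar_spectral_measure E w) B = ennreal (Re (cinner (E B w) w))"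
proof (rule emeasure_measure_of[OF scalar_spectral_measure_def])
  have nn: "0 \<le> inner (E A w) w" if A: "A \<in> sets borel" for A
  proof -
    obtain W where "orthogonal_projection X W (E A)"
      using E A by (auto simp: projection_valued_measure_def)
    from cinner_projection_self[OF this w] show ?thesis
      by (simp flip: Re_cinner)
  qed
  show "positive (sets (scalar_spectral_measure E w)) (\<lambda>B. ennreal (Re (cinner (E B w) w)))"
    using E w by (simp add: positive_def Re_cinner projection_valued_measure_def)
  show "countably_additive (sets (scalar_spectral_measure E w))
          (\<lambda>B. ennreal (Re (cinner (E B w) w)))"
  proof (rule countably_additiveI)
    fix A :: "nat \<Rightarrow> real set"
    assume A: "range A \<subseteq> sets (scalar_spectral_measure E w)" "disjoint_family A"
    have "(\<lambda>n. E (A n) w) sums E (\<Union>n. A n) w"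
      using E w A by (simp add: projection_valued_measure_def)
    then have "(\<lambda>n. inner (E (A n) w) w) sums inner (E (\<Union>n. A n) w) w"
      by (rule bounded_linear.sums[OF bounded_linear_inner_left])
    moreover have "0 \<le> inner (E (A n) w) w" for n
      using A by (intro nn) auto
    ultimately show "(\<Sum>n. ennreal (Re (cinner (E (A n) w) w)))
        = ennreal (Re (cinner (E (\<Union>n. A n) w) w))"
      by (simp add: Re_cinner sums_iff suminf_ennreal2)
  qed
qed (use B in auto)

text \<open>The compression is a self-adjoint operator defined on the whole of the closed subspace:\<close>

lemma self_adjoint_compression:
  assumes L: "self_adjoint_operator UNIV D L" and P: "orthogonal_projection UNIV V Q"
    and VD: "V \<subseteq> D"
  shows "self_adjoint_operator V V (compression Q L)"
proof -
  have V: "closed_csubspace V" and QV: "Q x \<in> V" and orth: "w \<in> V \<Longrightarrow> cinner (x - Q x) w = 0"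
    for x w
    using P by (auto simp: orthogonal_projection_def)
  have sub: "subspace V" and sc: "x \<in> V \<Longrightarrow> c *\<^sub>C x \<in> V" for c x
    using V by (auto simp: closed_csubspace_def csubspace_def)
  have Qc: "cinner (Q x) w = cinner x w" if "w \<in> V" for x w
    using orth[OF that, of x] cinner_add_left[of "x - Q x" "Q x" w] by simp
  have Qc': "cinner w (Q x) = cinner w x" if "w \<in> V" for x w
    using Qc[OF that, of x] by (metis cinner_commute)
  have ext: "a = b" if "a \<in> V" "b \<in> V" "\<And>w. w \<in> V \<Longrightarrow> cinner w a = cinner w b" for a b
  proof -
    have "inner (a - b) (a - b) = Re (cinner (a - b) a) - Re (cinner (a - b) b)"
      by (simp add: Re_cinner inner_diff_right)
    also have "\<dots> = 0"
      using that sub by (simp add: subspace_diff)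
    finally show ?thesis by simp
  qed
  have ext': "a = b" if "a \<in> V" "b \<in> V" "\<And>w. w \<in> V \<Longrightarrow> cinner a w = cinner b w" for a b
    using that by (intro ext) (metis cinner_commute)+
  have lin: "clinear_on D L" and adj: "adjoint_graph UNIV D L = operator_graph D L"
    using L by (auto simp: self_adjoint_operator_def)
  have sym: "cinner (L x) y = cinner x (L y)" if "x \<in> D" "y \<in> D" for x y
  proof -
    have "(y, L y) \<in> adjoint_graph UNIV D L"
      using adj that by (auto simp: operator_graph_def)
    then show ?thesis using that by (auto simp: adjoint_graph_def)
  qed
  have "Q (L (x + y)) = Q (L x) + Q (L y)" if "x \<in> V" "y \<in> V" for x y
  proof (rule ext')
    show "cinner (Q (L (x + y))) w = cinner (Q (L x) + Q (L y)) w" if w: "w \<in> V" for w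
      using that lin \<open>x \<in> V\<close> \<open>y \<in> V\<close> VD
      by (simp add: Qc cinner_add_left clinear_on_def subset_iff)
  qed (use QV sub in \<open>auto intro: subspace_add\<close>)
  moreover have "Q (L (c *\<^sub>C x)) = c *\<^sub>C Q (L x)" if "x \<in> V" for c x
  proof (rule ext')
    show "cinner (Q (L (c *\<^sub>C x))) w = cinner (c *\<^sub>C Q (L x)) w" if w: "w \<in> V" for w
      using that lin \<open>x \<in> V\<close> VD
      by (simp add: Qc cinner_scaleC_left clinear_on_def subset_iff)
  qed (use QV sc in auto)
  ultimately have "clinear_on V (compression Q L)"
    by (auto simp: clinear_on_def compression_def)
  moreover have "adjoint_graph V V (compression Q L) = operator_graph V (compression Q L)"
  proof -
    have *: "cinner (Q (L x)) y = cinner x (Q (L y))" if "x \<in> V" "y \<in> V" for x y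
      using that VD by (simp add: Qc Qc' sym subset_iff)
    have "z = Q (L y)" if "y \<in> V" "z \<in> V" "\<forall>x\<in>V. cinner (Q (L x)) y = cinner x z" for y z
      using that * QV by (intro ext) auto
    then show ?thesis
      using * QV by (auto simp: adjoint_graph_def operator_graph_def compression_def)
  qed
  ultimately show ?thesis
    using V QV closure_subset[of V]
    by (auto simp: self_adjoint_operator_def closed_csubspace_def compression_def)
qed

end

theory Submission
  imports Defs "HOL-Probability.Probability"
begin

text \<open>
  Write \<open>L\<^sub>n = P\<^sub>n L P\<^sub>n\<^sup>*\<close> and \<open>\<mu>\<^sub>n\<close>, \<open>\<mu>\<close> for the two scalar spectral measures.  The total masses
  \<open>\<parallel>P\<^sub>n v\<parallel>\<^sup>2\<close> converge to \<open>\<parallel>v\<parallel>\<^sup>2\<close>, and for finite measures on the line whose masses converge, weak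
  convergence follows as soon as \<open>\<integral> 1 / \<bar>t - z\<bar>\<^sup>2 d\<mu>\<^sub>n\<close> tends to \<open>\<integral> 1 / \<bar>t - z\<bar>\<^sup>2 d\<mu>\<close> for every
  non-real \<open>z\<close>.

  These integrals are accessible because \<open>\<integral> 1 / \<bar>t - z\<bar>\<^sup>2 d\<mu>\<^sub>x = \<parallel>y\<parallel>\<^sup>2\<close> if \<open>x = (L - z) y\<close>
  (\<open>integral_poisson_resolvent\<close>): the left-hand side is the squared norm of the resolvent applied to
  \<open>x\<close>.  Take \<open>u\<close> in the core and put \<open>x = (L - z) u\<close>, \<open>x\<^sub>n = (L\<^sub>n - z) P\<^sub>n u\<close>.  Then the integrals for
  \<open>x\<^sub>n\<close> are \<open>\<parallel>P\<^sub>n u\<parallel>\<^sup>2\<close> and tend to \<open>\<parallel>u\<parallel>\<^sup>2\<close>, the integral for \<open>x\<close>; the hypothesis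
  \<open>L P\<^sub>n u \<longlonglongrightarrow> L u\<close> gives \<open>x\<^sub>n \<longlonglongrightarrow> x\<close>.  A general \<open>v\<close> is handled by two facts: the vectors \<open>x\<close> of
  this form are dense (\<open>range_core_dense\<close>), and for bounded \<open>f \<ge> 0\<close> the integral \<open>\<integral> f d\<mu>\<^sub>x\<close> depends
  continuously on \<open>x\<close>, with a modulus of continuity that involves only a bound of \<open>f\<close> and the norms of
  the vectors, hence is uniform in \<open>n\<close> (\<open>integral_\<mu>_diff_le\<close>).

  The norm identity and the density both rest on two properties of the spectral projections:
  \<open>E(B)\<close> commutes with the operator (\<open>T_commutes\<close>), and on the range of \<open>E(B)\<close> the operator is within
  \<open>\<delta>\<close> of the scalar \<open>a\<close> if \<open>B\<close> lies in \<open>[a - \<delta>, a + \<delta>]\<close> (\<open>norm_T_le\<close>).  Cutting the line into cells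
  of small length then reduces each question to a multiplication operator with error \<open>\<delta>\<close>.

  For the measure-theoretic step, \<open>s \<mapsto> \<integral> 1 / ((t - s)\<^sup>2 + \<epsilon>\<^sup>2) d\<mu>\<^sub>n(t)\<close> is, up to a constant, the density
  of the convolution of \<open>\<mu>\<^sub>n\<close> with a Cauchy distribution.  These densities converge pointwise and so do their
  integrals, so by Scheffe's lemma they converge in \<open>L\<^sup>1\<close>.  Hence their Fourier transforms converge,
  and dividing by the transform of the kernel gives convergence of the characteristic
  functions of \<open>\<mu>\<^sub>n\<close>, to which Levy's continuity theorem applies.
\<close>

section \<open>Orthogonal projections in complex Hilbert spaces\<close>

lemma scaleC_diff_right: "c *\<^sub>C (x - y) = c *\<^sub>C x - c *\<^sub>C (y :: 'a::complex_vector)"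
  using scaleC_add_right[of c "x - y" y] by (simp add: algebra_simps)

lemma cinner_scaleC_right: "cinner x (c *\<^sub>C y) = cnj c * cinner x y"
  by (metis cinner_commute cinner_scaleC_left complex_cnj_cnj complex_cnj_mult)

lemma cinner_self: "cinner x x = complex_of_real ((norm x)\<^sup>2)"
proof -
  have "Im (cinner x x) = 0"
    using arg_cong[OF cinner_commute[of x x], of Im] by simp
  then show ?thesis
    by (simp add: complex_eq_iff Re_cinner power2_norm_eq_inner)
qed

lemma norm_scaleC: "norm (c *\<^sub>C x) = cmod c * norm (x :: 'a::complex_inner)"
proof -
  have "complex_of_real ((norm (c *\<^sub>C x))\<^sup>2) = complex_of_real ((cmod c * norm x)\<^sup>2)"
    by (simp only: cinner_self[symmetric] cinner_scaleC_left cinner_scaleC_right)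
       (simp only: cinner_self power_mult_distrib of_real_mult complex_norm_square[of c] ac_simps)
  then have "(norm (c *\<^sub>C x))\<^sup>2 = (cmod c * norm x)\<^sup>2"
    by (simp only: of_real_eq_iff)
  then show ?thesis by (simp add: power2_eq_iff_nonneg)
qed

lemma tendsto_scaleC:
  fixes c :: complex and x :: "'a::complex_inner"
  assumes "(f \<longlongrightarrow> x) F" shows "((\<lambda>n. c *\<^sub>C f n) \<longlongrightarrow> c *\<^sub>C x) F"
proof -
  have "((\<lambda>n. cmod c * norm (f n - x)) \<longlongrightarrow> 0) F"
    using assms by (intro tendsto_mult_right_zero tendsto_norm_zero) (simp add: LIM_zero)
  then have "((\<lambda>n. c *\<^sub>C f n - c *\<^sub>C x) \<longlongrightarrow> 0) F"
    by (subst tendsto_norm_zero_iff[symmetric]) (simp add: norm_scaleC flip: scaleC_diff_right)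
  then show ?thesis by (rule LIM_zero_cancel)
qed

lemma subspace_closure:
  fixes S :: "'a::real_normed_vector set"
  assumes "subspace S" shows "subspace (closure S)"
  unfolding subspace_def
proof (intro conjI ballI allI; unfold closure_sequential)
  show "\<exists>f. (\<forall>n. f n \<in> S) \<and> f \<longlonglongrightarrow> 0"
    using assms by (intro exI[of _ "\<lambda>_. 0"]) (auto intro: subspace_0)
next
  fix x y assume "\<exists>f. (\<forall>n. f n \<in> S) \<and> f \<longlonglongrightarrow> x" "\<exists>f. (\<forall>n. f n \<in> S) \<and> f \<longlonglongrightarrow> y"
  then obtain f g where "\<And>n. f n \<in> S" "f \<longlonglongrightarrow> x" "\<And>n. g n \<in> S" "g \<longlonglongrightarrow> y"
    by blast
  then have "\<forall>n. f n + g n \<in> S" "(\<lambda>n. f n + g n) \<longlonglongrightarrow> x + y"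
    using assms by (auto intro: subspace_add tendsto_add)
  then show "\<exists>h. (\<forall>n. h n \<in> S) \<and> h \<longlonglongrightarrow> x + y" by (intro exI conjI)
next
  fix c :: real and x assume "\<exists>f. (\<forall>n. f n \<in> S) \<and> f \<longlonglongrightarrow> x"
  then obtain f where "\<And>n. f n \<in> S" "f \<longlonglongrightarrow> x"
    by blast
  then have "\<forall>n. c *\<^sub>R f n \<in> S" "(\<lambda>n. c *\<^sub>R f n) \<longlonglongrightarrow> c *\<^sub>R x"
    using assms by (auto intro: subspace_scale tendsto_scaleR)
  then show "\<exists>h. (\<forall>n. h n \<in> S) \<and> h \<longlonglongrightarrow> c *\<^sub>R x" by (intro exI conjI)
qed

lemma closed_csubspaceD:
  assumes "closed_csubspace W"
  shows "subspace W" "closed W" "\<And>c x. x \<in> W \<Longrightarrow> c *\<^sub>C x \<in> W"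
  using assms by (auto simp: closed_csubspace_def csubspace_def)

context
  fixes X W :: "'a::chilbert_space set" and Q :: "'a \<Rightarrow> 'a"
  assumes X: "closed_csubspace X" and Q: "orthogonal_projection X W Q"
begin

lemma projection_in: "x \<in> X \<Longrightarrow> Q x \<in> W" "x \<in> X \<Longrightarrow> Q x \<in> X"
  using Q by (auto simp: orthogonal_projection_def)

lemma projection_orth: "x \<in> X \<Longrightarrow> w \<in> W \<Longrightarrow> inner (x - Q x) w = 0"
  using Q by (auto simp: orthogonal_projection_def simp flip: Re_cinner)

lemma projection_range: "subspace W" "\<And>c x. x \<in> W \<Longrightarrow> c *\<^sub>C x \<in> W" "W \<subseteq> X"
  using Q closed_csubspaceD[of W] by (auto simp: orthogonal_projection_def)

lemma projection_unique:
  assumes "x \<in> X" "y \<in> W" "\<And>w. w \<in> W \<Longrightarrow> inner (x - y) w = 0"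
  shows "Q x = y"
proof -
  have "Q x - y \<in> W"
    using assms by (intro subspace_diff[OF projection_range(1)] projection_in)
  then have "inner (x - y) (Q x - y) = 0" "inner (x - Q x) (Q x - y) = 0"
    using assms by (blast intro: projection_orth)+
  then have "inner (Q x - y) (Q x - y) = 0"
    unfolding inner_diff_left by linarith
  then show ?thesis unfolding inner_eq_zero_iff eq_iff_diff_eq_0[symmetric] .
qed

lemma projection_add: "x \<in> X \<Longrightarrow> y \<in> X \<Longrightarrow> Q (x + y) = Q x + Q y"
  using projection_range projection_in closed_csubspaceD[OF X]
  by (intro projection_unique subspace_add)
     (auto simp: add_diff_add inner_add_left projection_orth)

lemma projection_scaleC:
  assumes "x \<in> X" shows "Q (c *\<^sub>C x) = c *\<^sub>C Q x"
proof (rule projection_unique)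
  fix w assume w: "w \<in> W"
  have "cinner (x - Q x) w = 0"
    using Q w assms by (auto simp: orthogonal_projection_def)
  then show "inner (c *\<^sub>C x - c *\<^sub>C Q x) w = 0"
    by (simp add: cinner_scaleC_left flip: Re_cinner scaleC_diff_right)
qed (use assms projection_range projection_in closed_csubspaceD[OF X] in auto)

lemma projection_scaleR: "x \<in> X \<Longrightarrow> Q (r *\<^sub>R x) = r *\<^sub>R Q x"
  using projection_scaleC[of x "complex_of_real r"] by (simp add: scaleC_of_real)

lemma projection_diff:
  assumes "x \<in> X" "y \<in> X" shows "Q (x - y) = Q x - Q y"
proof -
  have "x - y \<in> X" using assms closed_csubspaceD[OF X] by (intro subspace_diff)
  then show ?thesis using projection_add[of "x - y" y] assms by simp
qed

lemma projection_symmetric: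
  assumes "x \<in> X" "y \<in> X" shows "inner (Q x) y = inner x (Q y)"
proof -
  have "inner (y - Q y) (Q x) = 0" "inner (x - Q x) (Q y) = 0"
    using assms by (auto intro: projection_orth projection_in)
  then show ?thesis
    by (simp add: inner_diff_left inner_diff_right inner_commute)
qed

lemma norm_projection_le:
  assumes "x \<in> X" shows "norm (Q x) \<le> norm x"
proof -
  have "(norm (Q x))\<^sup>2 = inner x (Q x)"
    using projection_orth[OF assms projection_in(1)[OF assms]]
    by (simp add: inner_diff_left power2_norm_eq_inner)
  also have "\<dots> \<le> norm x * norm (Q x)" by (rule norm_cauchy_schwarz)
  finally show ?thesis by (cases "Q x = 0") (auto simp: power2_eq_square)
qed

end

section \<open>Projection-valued measures\<close>

locale spectral_resolution =
  fixes X :: "'a::chilbert_space set" and E :: "real set \<Rightarrow> 'a \<Rightarrow> 'a"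
  assumes X: "closed_csubspace X" and E: "projection_valued_measure X E"
begin

abbreviation \<mu> :: "'a \<Rightarrow> real measure" where "\<mu> x \<equiv> scalar_spectral_measure E x"

lemma X_closed [intro, simp]:
  "x \<in> X \<Longrightarrow> y \<in> X \<Longrightarrow> x + y \<in> X" "x \<in> X \<Longrightarrow> y \<in> X \<Longrightarrow> x - y \<in> X"
  "x \<in> X \<Longrightarrow> c *\<^sub>C x \<in> X" "x \<in> X \<Longrightarrow> r *\<^sub>R x \<in> X" "0 \<in> X"
  using closed_csubspaceD[OF X] by (auto intro: subspace_add subspace_diff subspace_scale subspace_0)

lemma E_projection:
  assumes "B \<in> sets borel" obtains W where "orthogonal_projection X W (E B)"
  using E assms unfolding projection_valued_measure_def by blast

context
  fixes B :: "real set" assumes B: "B \<in> sets borel"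
begin

lemma E_in [intro, simp]: "x \<in> X \<Longrightarrow> E B x \<in> X"
  using E_projection[OF B] projection_in(2)[OF X] by metis
lemma E_add: "x \<in> X \<Longrightarrow> y \<in> X \<Longrightarrow> E B (x + y) = E B x + E B y"
  using E_projection[OF B] projection_add[OF X] by metis
lemma E_diff: "x \<in> X \<Longrightarrow> y \<in> X \<Longrightarrow> E B (x - y) = E B x - E B y"
  using E_projection[OF B] projection_diff[OF X] by metis
lemma E_scaleC: "x \<in> X \<Longrightarrow> E B (c *\<^sub>C x) = c *\<^sub>C E B x"
  using E_projection[OF B] projection_scaleC[OF X] by metis
lemma E_scaleR: "x \<in> X \<Longrightarrow> E B (r *\<^sub>R x) = r *\<^sub>R E B x"
  using E_projection[OF B] projection_scaleR[OF X] by metis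
lemma E_symmetric: "x \<in> X \<Longrightarrow> y \<in> X \<Longrightarrow> inner (E B x) y = inner x (E B y)"
  using E_projection[OF B] projection_symmetric[OF X] by metis
lemma norm_E_le: "x \<in> X \<Longrightarrow> norm (E B x) \<le> norm x"
  using E_projection[OF B] norm_projection_le[OF X] by metis

lemma E_Int: "A \<in> sets borel \<Longrightarrow> x \<in> X \<Longrightarrow> E (A \<inter> B) x = E A (E B x)"
  using E B unfolding projection_valued_measure_def by blast

lemma E_idem: "x \<in> X \<Longrightarrow> E B (E B x) = E B x"
  using E_Int[OF B] by (metis Int_absorb)

lemma emeasure_\<mu>: "x \<in> X \<Longrightarrow> emeasure (\<mu> x) B = ennreal ((norm (E B x))\<^sup>2)"
proof -
  assume x: "x \<in> X"
  obtain W where "orthogonal_projection X W (E B)" using E_projection[OF B] .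
  from cinner_projection_self[OF this x] show ?thesis
    by (simp add: emeasure_scalar_spectral_measure[OF E x B])
qed

end

lemma E_commute: "A \<in> sets borel \<Longrightarrow> B \<in> sets borel \<Longrightarrow> x \<in> X \<Longrightarrow> E A (E B x) = E B (E A x)"
  by (metis E_Int Int_commute)

lemma E_UNIV: "x \<in> X \<Longrightarrow> E UNIV x = x" and E_empty: "x \<in> X \<Longrightarrow> E {} x = 0"
  using E unfolding projection_valued_measure_def by blast+

lemma E_sums:
  "range A \<subseteq> sets borel \<Longrightarrow> disjoint_family A \<Longrightarrow> x \<in> X \<Longrightarrow> (\<lambda>n. E (A n) x) sums E (\<Union>n. A n) x"
  using E unfolding projection_valued_measure_def by blast

lemma space_\<mu> [simp]: "space (\<mu> x) = UNIV"
  using sets_eq_imp_space_eq[OF sets_scalar_spectral_measure[of E x]] by simp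

lemma measurable_\<mu> [simp]: "measurable (\<mu> x) N = measurable borel N"
  by (rule measurable_cong_sets) auto

lemma emeasure_\<mu>_UNIV: "x \<in> X \<Longrightarrow> emeasure (\<mu> x) UNIV = ennreal ((norm x)\<^sup>2)"
  by (simp add: emeasure_\<mu> E_UNIV)

lemma finite_measure_\<mu>: "x \<in> X \<Longrightarrow> finite_measure (\<mu> x)"
  by (rule finite_measureI) (simp add: emeasure_\<mu>_UNIV)

lemma measure_\<mu>_UNIV: "x \<in> X \<Longrightarrow> measure (\<mu> x) UNIV = (norm x)\<^sup>2"
  by (simp add: measure_def emeasure_\<mu>_UNIV)

lemma emeasure_\<mu>_E_le:
  assumes "x \<in> X" "B \<in> sets borel" "A \<in> sets borel"
  shows "emeasure (\<mu> (E B x)) A \<le> emeasure (\<mu> x) A"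
  using assms norm_E_le[of B "E A x"] by (simp add: emeasure_\<mu> E_commute[of A B])

lemma AE_\<mu>_range:
  assumes x: "x \<in> X" "E B x = x" and B: "B \<in> sets borel"
  shows "AE t in \<mu> x. t \<in> B"
proof (rule AE_I)
  have c: "- B \<in> sets borel" using B borel_comp by blast
  have "E (- B) x = E {} x"
    using E_Int[OF B c x(1)] x(2) by simp
  then show "emeasure (\<mu> x) (- B) = 0"
    using x c by (simp add: emeasure_\<mu> E_empty)
qed (use B in auto)

text \<open>
  Square roots of such integrals are seminorms in the vector; this is a form of their triangle
  inequality that can be checked on sets, by
  \<open>(a + b)\<^sup>2 \<le> (1 + c) a\<^sup>2 + (1 + 1/c) b\<^sup>2\<close>, and passes to sums.
\<close>

lemma nn_integral_\<mu>_le: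
  assumes x: "x \<in> X" and w: "w \<in> X" and c: "c > 0" and f: "f \<in> borel_measurable borel"
  shows "(\<integral>\<^sup>+t. f t \<partial>\<mu> x) \<le> ennreal (1 + c) * (\<integral>\<^sup>+t. f t \<partial>\<mu> w) + ennreal (1 + 1/c) * (\<integral>\<^sup>+t. f t \<partial>\<mu> (x - w))"
proof -
  have sets: "emeasure (\<mu> x) B \<le> ennreal (1 + c) * emeasure (\<mu> w) B + ennreal (1 + 1/c) * emeasure (\<mu> (x - w)) B"
    if B: "B \<in> sets borel" for B
  proof -
    define a b where "a = norm (E B w)" and "b = norm (E B (x - w))"
    have "norm (E B x) \<le> a + b"
      using norm_triangle_ineq[of "E B w" "E B (x - w)"] x w B by (simp add: a_def b_def E_diff)
    then have "(norm (E B x))\<^sup>2 \<le> (a + b)\<^sup>2" by (simp add: power_mono)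
    also have "\<dots> \<le> (1 + c) * a\<^sup>2 + (1 + 1/c) * b\<^sup>2"
    proof -
      have "0 \<le> (c * a - b)\<^sup>2 / c" using c by simp
      also have "\<dots> = c * a\<^sup>2 + b\<^sup>2 / c - 2 * a * b"
        using c by (simp add: field_simps power2_eq_square)
      finally show ?thesis by (simp add: field_simps power2_eq_square)
    qed
    finally show ?thesis
      using x w B c by (simp add: emeasure_\<mu> a_def b_def flip: ennreal_mult' ennreal_plus)
  qed
  \<comment> \<open>The inequality between the set functions carries over to simple functions by summation over
    their values.\<close>
  have simple: "(\<integral>\<^sup>Sy. g y \<partial>\<mu> x) \<le> ennreal (1 + c) * (\<integral>\<^sup>Sy. g y \<partial>\<mu> w) + ennreal (1 + 1/c) * (\<integral>\<^sup>Sy. g y \<partial>\<mu> (x - w))"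
    if g: "simple_function (\<mu> x) g" for g
  proof -
    have meas: "g -` {y} \<in> sets borel" for y
      using simple_functionD(2)[OF g, of "{y}"] by simp
    have "(\<integral>\<^sup>Sy. g y \<partial>\<mu> x) \<le> (\<Sum>y\<in>g ` UNIV. y * (ennreal (1 + c) * emeasure (\<mu> w) (g -` {y} \<inter> UNIV)
        + ennreal (1 + 1/c) * emeasure (\<mu> (x - w)) (g -` {y} \<inter> UNIV)))"
      unfolding simple_integral_def space_\<mu> by (intro sum_mono mult_left_mono sets) (auto simp: meas)
    also have "\<dots> = ennreal (1 + c) * (\<integral>\<^sup>Sy. g y \<partial>\<mu> w) + ennreal (1 + 1/c) * (\<integral>\<^sup>Sy. g y \<partial>\<mu> (x - w))"
      unfolding simple_integral_def space_\<mu>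
      by (simp add: sum_distrib_left sum.distrib distrib_left ac_simps)
    finally show ?thesis .
  qed
  show ?thesis
  proof (subst nn_integral_def, rule SUP_least, safe)
    fix g assume g: "simple_function (\<mu> x) g" "g \<le> f"
    then have s: "simple_function (\<mu> w) g" "simple_function (\<mu> (x - w)) g"
      by (auto simp: simple_function_def)
    have "(\<integral>\<^sup>Sy. g y \<partial>\<mu> x) \<le> ennreal (1 + c) * (\<integral>\<^sup>+y. g y \<partial>\<mu> w) + ennreal (1 + 1/c) * (\<integral>\<^sup>+y. g y \<partial>\<mu> (x - w))"
      using simple[OF g(1)] s by (simp add: nn_integral_eq_simple_integral)
    also have "\<dots> \<le> ennreal (1 + c) * (\<integral>\<^sup>+t. f t \<partial>\<mu> w) + ennreal (1 + 1/c) * (\<integral>\<^sup>+t. f t \<partial>\<mu> (x - w))"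
      using g by (intro add_mono mult_left_mono nn_integral_mono) (auto simp: le_fun_def)
    finally show "(\<integral>\<^sup>Sy. g y \<partial>\<mu> x) \<le> \<dots>" .
  qed
qed

text \<open>
  The bound depends neither on the space nor on the measure, so it applies uniformly to a
  sequence of spectral measures on varying subspaces.
\<close>

lemma integral_\<mu>_diff_le:
  assumes x: "x \<in> X" and w: "w \<in> X" and f: "f \<in> borel_measurable borel"
    and bounds: "\<And>t. 0 \<le> f t" "\<And>t. f t \<le> M"
  defines "d \<equiv> norm (x - w)"
  shows "\<bar>(\<integral>t. f t \<partial>\<mu> x) - (\<integral>t. f t \<partial>\<mu> w)\<bar> \<le> M * d * ((norm x)\<^sup>2 + (norm w)\<^sup>2 + d + 1)"
proof -
  have int: "integrable (\<mu> y) f" if "y \<in> X" for y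
  proof -
    interpret finite_measure "\<mu> y" using that by (rule finite_measure_\<mu>)
    show ?thesis using f bounds by (intro integrable_const_bound[where B = M]) auto
  qed
  have nn: "(\<integral>\<^sup>+t. f t \<partial>\<mu> y) = ennreal (\<integral>t. f t \<partial>\<mu> y)" if "y \<in> X" for y
    using int[OF that] bounds by (intro nn_integral_eq_integral) auto
  have I0: "0 \<le> (\<integral>t. f t \<partial>\<mu> y)" for y
    using bounds by (intro integral_nonneg_AE) auto
  have M0: "0 \<le> M" using bounds[of 0] by linarith
  have IM: "(\<integral>t. f t \<partial>\<mu> y) \<le> M * (norm y)\<^sup>2" if y: "y \<in> X" for y
  proof -
    interpret finite_measure "\<mu> y" using y by (rule finite_measure_\<mu>)
    have "(\<integral>t. f t \<partial>\<mu> y) \<le> (\<integral>t. M \<partial>\<mu> y)"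
      using bounds int[OF y] by (intro integral_mono) auto
    then show ?thesis using y by (simp add: measure_\<mu>_UNIV mult.commute)
  qed
  \<comment> \<open>The free parameter of the preceding inequality is taken to be the distance itself, so that both
    error terms are of first order in it.\<close>
  have one: "(\<integral>t. f t \<partial>\<mu> x) - (\<integral>t. f t \<partial>\<mu> w) \<le> M * e * ((norm w)\<^sup>2 + e + 1)"
    if xw: "x \<in> X" "w \<in> X" and e: "e = norm (x - w)" "e > 0" for x w e
  proof -
    have "ennreal (\<integral>t. f t \<partial>\<mu> x) \<le> ennreal ((1 + e) * (\<integral>t. f t \<partial>\<mu> w) + (1 + 1/e) * (\<integral>t. f t \<partial>\<mu> (x - w)))"
    proof -
      have "ennreal ((1 + e) * (\<integral>t. f t \<partial>\<mu> w) + (1 + 1/e) * (\<integral>t. f t \<partial>\<mu> (x - w)))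
          = ennreal (1 + e) * ennreal (\<integral>t. f t \<partial>\<mu> w) + ennreal (1 + 1/e) * ennreal (\<integral>t. f t \<partial>\<mu> (x - w))"
        using I0 e(2) by (subst ennreal_plus) (auto simp: ennreal_mult')
      then show ?thesis
        using nn_integral_\<mu>_le[OF xw e(2), of "\<lambda>t. ennreal (f t)"] f xw by (simp add: nn)
    qed
    then have "(\<integral>t. f t \<partial>\<mu> x) \<le> (1 + e) * (\<integral>t. f t \<partial>\<mu> w) + (1 + 1/e) * (\<integral>t. f t \<partial>\<mu> (x - w))"
      using I0 e(2) by (subst (asm) ennreal_le_iff) (auto intro!: add_nonneg_nonneg mult_nonneg_nonneg)
    also have "(1 + 1/e) * (\<integral>t. f t \<partial>\<mu> (x - w)) \<le> (1 + 1/e) * (M * e\<^sup>2)"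
      using IM[of "x - w"] xw e by (intro mult_left_mono) auto
    also have "(1 + 1/e) * (M * e\<^sup>2) = M * e * (e + 1)"
      using e(2) by (simp add: field_simps power2_eq_square)
    finally have "(\<integral>t. f t \<partial>\<mu> x) \<le> (1 + e) * (\<integral>t. f t \<partial>\<mu> w) + M * e * (e + 1)"
      by simp
    moreover have "e * (\<integral>t. f t \<partial>\<mu> w) \<le> e * (M * (norm w)\<^sup>2)"
      using e(2) IM[OF xw(2)] by (intro mult_left_mono) auto
    ultimately show ?thesis by argo
  qed
  show ?thesis
  proof (cases "d = 0")
    case True then show ?thesis by (simp add: d_def)
  next
    case False
    then have d: "d > 0" by (simp add: d_def)
    have "M * d * ((norm y)\<^sup>2 + d + 1) \<le> M * d * ((norm x)\<^sup>2 + (norm w)\<^sup>2 + d + 1)" if "y = x \<or> y = w" for y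
      using that M0 d by (intro mult_left_mono) auto
    note bound = this[of x] this[of w]
    have "(\<integral>t. f t \<partial>\<mu> x) - (\<integral>t. f t \<partial>\<mu> w) \<le> M * d * ((norm w)\<^sup>2 + d + 1)"
      by (rule one[OF x w _ d]) (simp add: d_def)
    moreover have "(\<integral>t. f t \<partial>\<mu> w) - (\<integral>t. f t \<partial>\<mu> x) \<le> M * d * ((norm x)\<^sup>2 + d + 1)"
      by (rule one[OF w x _ d]) (simp add: d_def norm_minus_commute)
    ultimately show ?thesis
      unfolding abs_le_iff minus_diff_eq using bound by (meson order_trans)
  qed
qed

end

section \<open>Spectral calculus of a self-adjoint operator\<close>

text \<open>
  The cells of length \<open>\<delta>\<close> of the line, numbered by the natural numbers because countable
  additivity of a projection-valued measure is stated for sequences.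
\<close>

definition grid_cell :: "real \<Rightarrow> nat \<Rightarrow> real set" where
  "grid_cell \<delta> n = {t. \<lfloor>t / \<delta>\<rfloor> = int_decode n}"

lemma grid_cell_measurable [measurable]: "grid_cell \<delta> n \<in> sets borel"
  unfolding grid_cell_def by measurable

lemma disjoint_grid_cells: "disjoint_family (grid_cell \<delta>)"
proof -
  have "int_decode m = int_decode n \<Longrightarrow> m = n" for m n
    by (metis int_decode_inverse)
  then show ?thesis by (fastforce simp: disjoint_family_on_def grid_cell_def)
qed

lemma Union_grid_cells: "(\<Union>n. grid_cell \<delta> n) = UNIV"
  by (auto simp: grid_cell_def) (metis int_encode_inverse)

lemma grid_cell_subset:
  assumes "\<delta> > 0" shows "\<exists>a. grid_cell \<delta> n \<subseteq> {a - \<delta>..a + \<delta>}"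
proof (intro exI subsetI)
  fix t assume "t \<in> grid_cell \<delta> n"
  then have "real_of_int (int_decode n) \<le> t / \<delta>" "t / \<delta> < real_of_int (int_decode n) + 1"
    by (simp_all add: grid_cell_def floor_eq_iff)
  then show "t \<in> {\<delta> * real_of_int (int_decode n) - \<delta>..\<delta> * real_of_int (int_decode n) + \<delta>}"
    using assms by (simp add: field_simps)
qed

locale spectral_operator = spectral_resolution X E
  for X :: "'a::chilbert_space set" and E +
  fixes D :: "'a set" and T :: "'a \<Rightarrow> 'a"
  assumes self_adjoint: "self_adjoint_operator X D T" and spectral: "is_spectral_measure X D T E"
begin

lemma D_X: "x \<in> D \<Longrightarrow> x \<in> X"
  using self_adjoint by (auto simp: self_adjoint_operator_def)

lemma T_in: "x \<in> D \<Longrightarrow> T x \<in> X"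
  using self_adjoint by (auto simp: self_adjoint_operator_def)

lemma D_closed [intro, simp]:
  "x \<in> D \<Longrightarrow> y \<in> D \<Longrightarrow> x + y \<in> D" "x \<in> D \<Longrightarrow> y \<in> D \<Longrightarrow> x - y \<in> D"
  "x \<in> D \<Longrightarrow> c *\<^sub>C x \<in> D" "x \<in> D \<Longrightarrow> r *\<^sub>R x \<in> D" "0 \<in> D"
  using self_adjoint
  by (auto simp: self_adjoint_operator_def csubspace_def
      intro: subspace_add subspace_diff subspace_scale subspace_0)

lemma T_add: "x \<in> D \<Longrightarrow> y \<in> D \<Longrightarrow> T (x + y) = T x + T y"
  using self_adjoint by (auto simp: self_adjoint_operator_def clinear_on_def)

lemma T_scaleC: "x \<in> D \<Longrightarrow> T (c *\<^sub>C x) = c *\<^sub>C T x"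
  using self_adjoint by (auto simp: self_adjoint_operator_def clinear_on_def)

lemma T_scaleR: "x \<in> D \<Longrightarrow> T (r *\<^sub>R x) = r *\<^sub>R T x"
  using T_scaleC[of x "complex_of_real r"] by (simp add: scaleC_of_real)

lemma T_diff: "x \<in> D \<Longrightarrow> y \<in> D \<Longrightarrow> T (x - y) = T x - T y"
  using T_add[of "x - y" y] by simp

lemma T_symmetric:
  assumes "x \<in> D" "y \<in> D" shows "inner (T x) y = inner x (T y)"
proof -
  have "(y, T y) \<in> adjoint_graph X D T"
    using self_adjoint assms by (auto simp: self_adjoint_operator_def operator_graph_def)
  then show ?thesis
    using assms by (auto simp: adjoint_graph_def simp flip: Re_cinner)
qed

lemma orthogonal_domain_eq_0:
  assumes u: "u \<in> X" and orth: "\<And>d. d \<in> D \<Longrightarrow> inner u d = 0"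
  shows "u = 0"
proof -
  have "u \<in> closure D"
    using self_adjoint u by (auto simp: self_adjoint_operator_def)
  then obtain d where d: "\<And>n. d n \<in> D" "d \<longlonglongrightarrow> u"
    by (auto simp: closure_sequential)
  have "(\<lambda>n. inner u (d n)) \<longlonglongrightarrow> inner u u"
    using d(2) by (intro tendsto_intros)
  then have "inner u u = 0"
    using orth[OF d(1)] by (simp add: LIMSEQ_const_iff)
  then show ?thesis by simp
qed

lemma D_iff: "x \<in> D \<longleftrightarrow> x \<in> X \<and> integrable (\<mu> x) (\<lambda>t. t\<^sup>2)"
  using spectral by (auto simp: is_spectral_measure_def)

lemma integrable_id: "x \<in> D \<Longrightarrow> integrable (\<mu> x) (\<lambda>t. t)"
  using finite_measure.square_integrable_imp_integrable[OF finite_measure_\<mu>, of x "\<lambda>t. t"]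
  by (auto simp: D_iff)

lemma quadratic_form: "x \<in> D \<Longrightarrow> inner (T x) x = (\<integral>t. t \<partial>\<mu> x)"
  using spectral by (auto simp: is_spectral_measure_def simp flip: Re_cinner)

text \<open>
  The scalar measure of \<open>E B x\<close> is that of \<open>x\<close> restricted to \<open>B\<close>, so its second moment is still
  finite.
\<close>

lemma E_domain:
  assumes x: "x \<in> D" and B: "B \<in> sets borel" shows "E B x \<in> D"
proof -
  have "\<mu> (E B x) \<le> \<mu> x"
    using emeasure_\<mu>_E_le[OF D_X[OF x] B] by (subst le_measure) auto
  then have "(\<integral>\<^sup>+t. ennreal (t\<^sup>2) \<partial>\<mu> (E B x)) \<le> (\<integral>\<^sup>+t. ennreal (t\<^sup>2) \<partial>\<mu> x)"
    by (intro nn_integral_mono_measure) auto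
  then show ?thesis
    using x B by (auto simp: D_iff integrable_iff_bounded)
qed

text \<open>
  For \<open>x\<close> in the range and \<open>w\<close> in the kernel of \<open>E B\<close> the cross terms in the scalar measures of
  \<open>x + w\<close> and \<open>x - w\<close> vanish, so the two measures agree.  The quadratic form of \<open>T\<close> is determined by
  the scalar measure, and polarization leaves nothing.
\<close>

lemma T_orthogonal:
  assumes x: "x \<in> D" "E B x = x" and w: "w \<in> D" "E B w = 0" and B: "B \<in> sets borel"
  shows "inner (T x) w = 0"
proof -
  have "\<mu> (x + w) = \<mu> (x - w)"
  proof (rule measure_eqI)
    fix A assume "A \<in> sets (\<mu> (x + w))"
    then have A: "A \<in> sets borel" by simp
    have "inner (E A x) (E A w) = inner (E B (E A x)) (E A w)"
      using E_commute[OF A B D_X[OF x(1)]] x(2) by simp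
    also have "\<dots> = inner (E A x) (E A (E B w))"
      using x w A B by (metis D_X E_in E_symmetric E_commute)
    also have "E A (E B w) = 0"
      using w(2) E_scaleR[OF A, of 0 0] by simp
    finally have "inner (E A x) (E A w) = 0" by simp
    then have "(norm (E A (x + w)))\<^sup>2 = (norm (E A (x - w)))\<^sup>2"
      using x w A
      by (simp add: E_add E_diff D_X power2_norm_eq_inner inner_add_left inner_add_right
          inner_diff_left inner_diff_right inner_commute)
    then show "emeasure (\<mu> (x + w)) A = emeasure (\<mu> (x - w)) A"
      using x w A by (simp add: emeasure_\<mu> D_X)
  qed simp
  then have "inner (T (x + w)) (x + w) = inner (T (x - w)) (x - w)"
    using x w by (simp add: quadratic_form)
  then show ?thesis
    using x w T_symmetric[of w x]
    by (simp add: T_add T_diff inner_add_left inner_add_right inner_diff_left inner_diff_right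
        inner_commute)
qed

text \<open>
  The quadratic form has no mixed terms between the range and the kernel of \<open>E B\<close>, so \<open>E B (T y)\<close> and
  \<open>T (E B y)\<close> have the same inner product with every vector of the dense domain.
\<close>

lemma T_commutes:
  assumes y: "y \<in> D" and B: "B \<in> sets borel"
  shows "E B (T y) = T (E B y)"
proof -
  have "E B (T y) - T (E B y) = 0"
  proof (rule orthogonal_domain_eq_0)
    fix d assume d: "d \<in> D"
    have split: "inner (T u) w = inner (T (E B u)) (E B w)"
      if "u \<in> D" "w \<in> D" "E B u = u \<or> E B w = w" for u w
    proof -
      have ker: "E B (a - E B a) = 0" if "a \<in> D" for a
        using that B by (simp add: E_diff E_idem D_X)
      show ?thesis
      proof (cases "E B u = u")
        case True
        then have "inner (T u) (w - E B w) = 0"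
          using that B by (intro T_orthogonal[OF _ _ _ _ B] ker) (auto intro: E_domain)
        then show ?thesis using True by (simp add: inner_diff_right)
      next
        case False
        then have w: "E B w = w" using that by simp
        then have "inner (T w) (u - E B u) = 0"
          using that B by (intro T_orthogonal[OF _ _ _ _ B] ker) (auto intro: E_domain)
        then have "inner (T (u - E B u)) w = 0"
          using that B by (subst T_symmetric) (auto simp: inner_commute intro: E_domain)
        then show ?thesis
          using w that B by (simp add: T_diff E_domain inner_diff_left)
      qed
    qed
    have "inner (E B (T y)) d = inner (T (E B y)) (E B d)"
      using split[of y "E B d"] y d B by (simp add: E_symmetric E_domain E_idem D_X T_in)
    also have "\<dots> = inner (T (E B y)) d"
      using split[of "E B y" d] y d B by (simp add: E_domain E_idem D_X)
    finally show "inner (E B (T y) - T (E B y)) d = 0" by (simp add: inner_diff_left)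
  qed (use y B in \<open>auto intro: T_in E_domain\<close>)
  then show ?thesis by simp
qed

text \<open>
  On the range of \<open>E B\<close> the scalar measures live on \<open>B\<close>, so the quadratic form of \<open>T - a\<close> is bounded
  by \<open>\<delta>\<close>; for a symmetric operator that preserves this range the same bound holds for the norm.
\<close>

lemma norm_T_le:
  assumes x: "x \<in> X" "E B x = x" and B: "B \<in> sets borel" "B \<subseteq> {a - \<delta>..a + \<delta>}"
  shows "x \<in> D" and "norm (T x - a *\<^sub>R x) \<le> \<delta> * norm x"
proof -
  have near: "\<bar>t - a\<bar> \<le> \<delta>" if "t \<in> B" for t
    using subsetD[OF B(2) that] by (auto simp: abs_le_iff)
  have in_D: "w \<in> D" if w: "w \<in> X" "E B w = w" for w
  proof -
    interpret finite_measure "\<mu> w" using w(1) by (rule finite_measure_\<mu>)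
    have "AE t in \<mu> w. norm (t\<^sup>2) \<le> (\<bar>a\<bar> + \<bar>\<delta>\<bar>)\<^sup>2"
      using AE_\<mu>_range[OF w B(1)]
    proof eventually_elim
      case (elim t)
      then have "\<bar>t\<bar> \<le> \<bar>a\<bar> + \<bar>\<delta>\<bar>" using near[of t] elim by linarith
      then have "\<bar>t\<bar>\<^sup>2 \<le> (\<bar>a\<bar> + \<bar>\<delta>\<bar>)\<^sup>2" by (intro power_mono) auto
      then show ?case by simp
    qed
    then have "integrable (\<mu> w) (\<lambda>t. t\<^sup>2)"
      by (rule integrable_const_bound) simp
    then show ?thesis using w by (simp add: D_iff)
  qed
  show D: "x \<in> D" using in_D[OF x] .
  define b where "b p q = inner (T p - a *\<^sub>R p) q" for p q
  have quad: "\<bar>b w w\<bar> \<le> \<delta> * (norm w)\<^sup>2" if w: "w \<in> X" "E B w = w" for w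
  proof -
    interpret finite_measure "\<mu> w" using w(1) by (rule finite_measure_\<mu>)
    have wD: "w \<in> D" using in_D[OF w] .
    have int: "integrable (\<mu> w) (\<lambda>t. t - a)" using integrable_id[OF wD] by auto
    have "b w w = (\<integral>t. t - a \<partial>\<mu> w)"
      using wD w(1) integrable_id[OF wD]
      by (simp add: b_def inner_diff_left quadratic_form measure_\<mu>_UNIV power2_norm_eq_inner)
    also have "\<bar>\<dots>\<bar> \<le> (\<integral>t. \<bar>t - a\<bar> \<partial>\<mu> w)" by (rule integral_abs_bound)
    also have "\<dots> \<le> (\<integral>t. \<delta> \<partial>\<mu> w)"
    proof (rule integral_mono_AE)
      show "AE t in \<mu> w. \<bar>t - a\<bar> \<le> \<delta>"
        using AE_\<mu>_range[OF w B(1)] by eventually_elim (rule near)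
    qed (use int in auto)
    also have "\<dots> = \<delta> * (norm w)\<^sup>2" using w(1) by (simp add: measure_\<mu>_UNIV)
    finally show ?thesis .
  qed
  define u where "u = T x - a *\<^sub>R x"
  have u: "u \<in> X" "E B u = u"
    using D x B by (auto simp: u_def T_in E_diff E_scaleR T_commutes)
  show "norm (T x - a *\<^sub>R x) \<le> \<delta> * norm x"
  proof (cases "u = 0 \<or> x = 0")
    case True
    moreover have "T 0 = 0" using T_diff[of 0 0] by simp
    ultimately have "u = 0" by (auto simp: u_def)
    moreover have "0 \<le> \<delta> * (norm x)\<^sup>2" using quad[OF x] by linarith
    ultimately show ?thesis
      by (cases "x = 0") (auto simp: u_def zero_le_mult_iff)
  next
    case False
    then have pos: "norm u > 0" "norm x > 0" by auto
    \<comment> \<open>Polarization bounds the form at \<open>x\<close> and \<open>w\<close> by the mean of their squared norms.  Rescaling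
      \<open>u = (T - a) x\<close> to the norm of \<open>x\<close> makes this bound equal to \<open>\<delta> \<parallel>x\<parallel>\<^sup>2\<close>, while the form is
      \<open>\<parallel>x\<parallel> \<parallel>u\<parallel>\<close>.\<close>
    define w where "w = (norm x / norm u) *\<^sub>R u"
    have w: "w \<in> X" "E B w = w" using u B by (auto simp: w_def E_scaleR)
    have nw: "norm w = norm x" using pos by (simp add: w_def)
    have sym: "b w x = b x w"
    proof -
      have "inner (T w) x = inner (T x) w"
        using T_symmetric[OF in_D[OF w] D] by (metis inner_commute)
      moreover have "inner w x = inner x w" by (rule inner_commute)
      ultimately show ?thesis by (simp add: b_def inner_diff_left)
    qed
    have "4 * b x w = b (x + w) (x + w) - b (x - w) (x - w)"
      using sym D in_D[OF w]
      by (simp add: b_def T_add T_diff inner_add_left inner_add_right inner_diff_left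
          inner_diff_right scaleR_add_right scaleR_diff_right)
    also have "\<dots> \<le> \<delta> * (norm (x + w))\<^sup>2 + \<delta> * (norm (x - w))\<^sup>2"
      using quad[of "x + w"] quad[of "x - w"] x w B by (simp add: E_add E_diff)
    also have "\<dots> = \<delta> * (2 * (norm x)\<^sup>2 + 2 * (norm w)\<^sup>2)"
      by (simp add: power2_norm_eq_inner inner_add_left inner_add_right inner_diff_left
          inner_diff_right algebra_simps)
    finally have "b x w \<le> \<delta> * (norm x)\<^sup>2" using nw by simp
    moreover have "b x w = norm x * norm u"
      using pos by (simp add: b_def w_def flip: u_def power2_norm_eq_inner)
        (simp add: power2_eq_square)
    ultimately show ?thesis
      using pos by (simp add: u_def[symmetric] power2_eq_square)
  qed
qed

lemma T_minus_in: "y \<in> D \<Longrightarrow> T y - z *\<^sub>C y \<in> X"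
  by (auto intro: T_in D_X)

text \<open>
  On a cell around \<open>a\<close> the vector \<open>(T - z) y\<close> is \<open>(a - z) y\<close> up to a small relative error, while
  \<open>1 / \<bar>t - z\<bar>\<^sup>2\<close> is \<open>1 / \<bar>a - z\<bar>\<^sup>2\<close> up to a small factor: the two effects cancel.  The errors are
  multiplicative since \<open>\<bar>a - z\<bar>\<close> is bounded below by \<open>\<bar>Im z\<bar>\<close>, so the comparison can be summed
  over all cells, and it becomes exact as their length tends to \<open>0\<close>.
\<close>

lemma integral_poisson_resolvent:
  assumes y: "y \<in> D" and z: "Im z \<noteq> 0"
  shows "(\<integral>t. 1 / (cmod (complex_of_real t - z))\<^sup>2 \<partial>\<mu> (T y - z *\<^sub>C y)) = (norm y)\<^sup>2"
proof -
  define x where "x = T y - z *\<^sub>C y"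
  define g where "g t = 1 / (cmod (complex_of_real t - z))\<^sup>2" for t
  define \<epsilon> where "\<epsilon> = \<bar>Im z\<bar>"
  have \<epsilon>: "\<epsilon> > 0" using z by (simp add: \<epsilon>_def)
  have x: "x \<in> X" using y by (auto simp: x_def intro: T_minus_in)
  interpret finite_measure "\<mu> x" using x by (rule finite_measure_\<mu>)
  have far: "\<epsilon> \<le> cmod (complex_of_real t - z)" for t
    using abs_Im_le_cmod[of "complex_of_real t - z"] by (simp add: \<epsilon>_def)
  have g_meas [measurable]: "g \<in> borel_measurable borel" unfolding g_def by measurable
  have g_bound: "0 \<le> g t" "g t \<le> 1 / \<epsilon>\<^sup>2" for t
    using far[of t] \<epsilon> by (auto simp: g_def intro!: divide_left_mono power_mono mult_pos_pos)
  have int: "integrable (\<mu> x) g"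
    using g_bound by (intro integrable_const_bound[where B = "1 / \<epsilon>\<^sup>2"]) auto
  define N where "N = density (\<mu> x) (\<lambda>t. ennreal (g t))"
  have N_sets [simp]: "sets N = sets borel" by (simp add: N_def)
  have N: "emeasure N UNIV = ennreal (\<integral>t. g t \<partial>\<mu> x)"
    using int g_bound by (simp add: N_def emeasure_density nn_integral_eq_integral)
  \<comment> \<open>Cells of length \<open>\<eta> \<bar>Im z\<bar>\<close> give relative error \<open>\<eta>\<close> both for the vector and for the weight.\<close>
  have cell_est: "emeasure N C \<le> ennreal (((1 + \<eta>) / (1 - \<eta>))\<^sup>2) * emeasure (\<mu> y) C"
      "emeasure (\<mu> y) C \<le> ennreal (((1 + \<eta>) / (1 - \<eta>))\<^sup>2) * emeasure N C"
    if \<eta>: "0 < \<eta>" "\<eta> < 1" and C: "C = grid_cell (\<eta> * \<epsilon>) n" for C \<eta> n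
  proof -
    define \<delta> where "\<delta> = \<eta> * \<epsilon>"
    have \<delta>: "\<delta> > 0" using \<eta> \<epsilon> by (simp add: \<delta>_def)
    have Cb [measurable]: "C \<in> sets borel" using C by simp
    obtain a where a: "C \<subseteq> {a - \<delta>..a + \<delta>}"
      using grid_cell_subset[OF \<delta>] C \<delta>_def by blast
    define r where "r = cmod (complex_of_real a - z)"
    have r: "r > 0" "\<delta> \<le> \<eta> * r" using far[of a] \<epsilon> \<eta> by (auto simp: r_def \<delta>_def)
    define p where "p = E C y"
    define q where "q = E C x"
    have p: "p \<in> X" "E C p = p" using y Cb by (auto simp: p_def D_X E_idem)
    have q_eq: "q = T p - z *\<^sub>C p"
      using y Cb by (simp add: p_def q_def x_def E_diff E_scaleC T_commutes T_in D_X)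
    have "(complex_of_real a - z) *\<^sub>C p = a *\<^sub>R p - z *\<^sub>C p"
      using scaleC_add_left[of "complex_of_real a - z" z p] by (simp add: scaleC_of_real)
    then have "norm (q - (complex_of_real a - z) *\<^sub>C p) \<le> \<delta> * norm p"
      using norm_T_le(2)[OF p Cb a] by (simp add: q_eq)
    then have "\<bar>norm q - r * norm p\<bar> \<le> \<delta> * norm p"
      using norm_triangle_ineq3[of q "(complex_of_real a - z) *\<^sub>C p"]
      by (simp add: norm_scaleC r_def)
    also have "\<dots> \<le> \<eta> * r * norm p" using r by (intro mult_right_mono) auto
    finally have q_lo: "(1 - \<eta>) * r * norm p \<le> norm q" and q_hi: "norm q \<le> (1 + \<eta>) * r * norm p"
      by (auto simp: algebra_simps abs_le_iff)
    have g_est: "1 / ((1 + \<eta>) * r)\<^sup>2 \<le> g t" "g t \<le> 1 / ((1 - \<eta>) * r)\<^sup>2" if "t \<in> C" for t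
    proof -
      have "\<bar>cmod (complex_of_real t - z) - r\<bar> \<le> \<bar>t - a\<bar>"
        using norm_triangle_ineq3[of "complex_of_real t - z" "complex_of_real a - z"]
        by (simp add: r_def flip: of_real_diff)
      also have "\<bar>t - a\<bar> \<le> \<delta>"
      proof -
        have "t \<in> {a - \<delta>..a + \<delta>}" using that a by blast
        then show ?thesis by (simp add: abs_le_iff)
      qed
      also note r(2)
      finally have "(1 - \<eta>) * r \<le> cmod (complex_of_real t - z)"
          "cmod (complex_of_real t - z) \<le> (1 + \<eta>) * r"
        by (auto simp: algebra_simps abs_le_iff)
      moreover have "0 < (1 - \<eta>) * r" using \<eta> r by simp
      ultimately show "1 / ((1 + \<eta>) * r)\<^sup>2 \<le> g t" "g t \<le> 1 / ((1 - \<eta>) * r)\<^sup>2"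
        unfolding g_def by (auto intro!: frac_le power_mono zero_less_power)
    qed
    have \<mu>xC: "emeasure (\<mu> x) C = ennreal ((norm q)\<^sup>2)" and \<mu>yC: "emeasure (\<mu> y) C = ennreal ((norm p)\<^sup>2)"
      using x y Cb by (auto simp: emeasure_\<mu> q_def p_def D_X)
    have NC: "emeasure N C = (\<integral>\<^sup>+t. ennreal (g t) * indicator C t \<partial>\<mu> x)"
      by (simp add: N_def emeasure_density)
    have const: "(\<integral>\<^sup>+t. ennreal c * indicator C t \<partial>\<mu> x) = ennreal (c * (norm q)\<^sup>2)" if "0 \<le> c" for c
      using that by (simp add: nn_integral_cmult_indicator \<mu>xC ennreal_mult')
    have "emeasure N C \<le> (\<integral>\<^sup>+t. ennreal (1 / ((1 - \<eta>) * r)\<^sup>2) * indicator C t \<partial>\<mu> x)"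
      unfolding NC using g_est by (intro nn_integral_mono) (auto simp: indicator_def intro: ennreal_leI)
    also have "\<dots> = ennreal (1 / ((1 - \<eta>) * r)\<^sup>2 * (norm q)\<^sup>2)" by (rule const) simp
    also have "\<dots> \<le> ennreal (1 / ((1 - \<eta>) * r)\<^sup>2 * ((1 + \<eta>) * r * norm p)\<^sup>2)"
      using q_hi by (intro ennreal_leI mult_left_mono power_mono) auto
    also have "1 / ((1 - \<eta>) * r)\<^sup>2 * ((1 + \<eta>) * r * norm p)\<^sup>2 = ((1 + \<eta>) / (1 - \<eta>))\<^sup>2 * (norm p)\<^sup>2"
      using r by (simp add: power_mult_distrib power_divide)
    finally show "emeasure N C \<le> ennreal (((1 + \<eta>) / (1 - \<eta>))\<^sup>2) * emeasure (\<mu> y) C"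
      by (simp add: \<mu>yC ennreal_mult')
    have "ennreal (((1 - \<eta>) / (1 + \<eta>))\<^sup>2 * (norm p)\<^sup>2)
        = ennreal (1 / ((1 + \<eta>) * r)\<^sup>2 * ((1 - \<eta>) * r * norm p)\<^sup>2)"
      using r by (simp add: power_mult_distrib power_divide)
    also have "\<dots> \<le> ennreal (1 / ((1 + \<eta>) * r)\<^sup>2 * (norm q)\<^sup>2)"
      using q_lo \<eta> r by (intro ennreal_leI mult_left_mono power_mono) auto
    also have "\<dots> = (\<integral>\<^sup>+t. ennreal (1 / ((1 + \<eta>) * r)\<^sup>2) * indicator C t \<partial>\<mu> x)"
      by (rule const[symmetric]) simp
    also have "\<dots> \<le> emeasure N C"
      unfolding NC using g_est by (intro nn_integral_mono) (auto simp: indicator_def intro: ennreal_leI)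
    finally have lower: "ennreal (((1 - \<eta>) / (1 + \<eta>))\<^sup>2 * (norm p)\<^sup>2) \<le> emeasure N C" .
    have "((1 + \<eta>) / (1 - \<eta>))\<^sup>2 * (((1 - \<eta>) / (1 + \<eta>))\<^sup>2 * (norm p)\<^sup>2) = (norm p)\<^sup>2"
      using \<eta> by (simp add: power_divide)
    then have "emeasure (\<mu> y) C = ennreal (((1 + \<eta>) / (1 - \<eta>))\<^sup>2) * ennreal (((1 - \<eta>) / (1 + \<eta>))\<^sup>2 * (norm p)\<^sup>2)"
      by (simp add: \<mu>yC flip: ennreal_mult')
    also have "\<dots> \<le> ennreal (((1 + \<eta>) / (1 - \<eta>))\<^sup>2) * emeasure N C"
      using lower by (rule mult_left_mono) simp
    finally show "emeasure (\<mu> y) C \<le> ennreal (((1 + \<eta>) / (1 - \<eta>))\<^sup>2) * emeasure N C" .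
  qed
  have sum: "emeasure M1 UNIV \<le> ennreal c * emeasure M2 UNIV"
    if M: "sets M1 = sets borel" "sets M2 = sets borel"
      and le: "\<And>n. emeasure M1 (grid_cell \<delta> n) \<le> ennreal c * emeasure M2 (grid_cell \<delta> n)" for M1 M2 c \<delta>
  proof -
    have "emeasure M1 UNIV = (\<Sum>n. emeasure M1 (grid_cell \<delta> n))"
      using suminf_emeasure[of "grid_cell \<delta>" M1] M by (simp add: disjoint_grid_cells Union_grid_cells image_subset_iff)
    also have "\<dots> \<le> (\<Sum>n. ennreal c * emeasure M2 (grid_cell \<delta> n))"
      by (intro suminf_le le) auto
    also have "\<dots> = ennreal c * (\<Sum>n. emeasure M2 (grid_cell \<delta> n))" by simp
    also have "(\<Sum>n. emeasure M2 (grid_cell \<delta> n)) = emeasure M2 UNIV"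
      using suminf_emeasure[of "grid_cell \<delta>" M2] M by (simp add: disjoint_grid_cells Union_grid_cells image_subset_iff)
    finally show ?thesis .
  qed
  have I0: "0 \<le> (\<integral>t. g t \<partial>\<mu> x)" using g_bound by (intro integral_nonneg_AE) auto
  have total: "(\<integral>t. g t \<partial>\<mu> x) \<le> ((1 + \<eta>) / (1 - \<eta>))\<^sup>2 * (norm y)\<^sup>2"
      "(norm y)\<^sup>2 \<le> ((1 + \<eta>) / (1 - \<eta>))\<^sup>2 * (\<integral>t. g t \<partial>\<mu> x)" if \<eta>: "0 < \<eta>" "\<eta> < 1" for \<eta>
  proof -
    have "emeasure N UNIV \<le> ennreal (((1 + \<eta>) / (1 - \<eta>))\<^sup>2) * emeasure (\<mu> y) UNIV"
      using cell_est(1)[OF \<eta> refl] by (intro sum[where \<delta> = "\<eta> * \<epsilon>"]) auto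
    then show "(\<integral>t. g t \<partial>\<mu> x) \<le> ((1 + \<eta>) / (1 - \<eta>))\<^sup>2 * (norm y)\<^sup>2"
      using y I0 by (simp add: N emeasure_\<mu>_UNIV D_X flip: ennreal_mult')
    have "emeasure (\<mu> y) UNIV \<le> ennreal (((1 + \<eta>) / (1 - \<eta>))\<^sup>2) * emeasure N UNIV"
      using cell_est(2)[OF \<eta> refl] by (intro sum[where \<delta> = "\<eta> * \<epsilon>"]) auto
    then show "(norm y)\<^sup>2 \<le> ((1 + \<eta>) / (1 - \<eta>))\<^sup>2 * (\<integral>t. g t \<partial>\<mu> x)"
      using y I0 by (simp add: N emeasure_\<mu>_UNIV D_X flip: ennreal_mult')
  qed
  have lim: "((\<lambda>\<eta>. ((1 + \<eta>) / (1 - \<eta>))\<^sup>2 * c) \<longlongrightarrow> c) (at_right 0)" for c :: real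
    by (auto intro!: tendsto_eq_intros)
  have small: "\<forall>\<^sub>F \<eta> in at_right 0. 0 < \<eta> \<and> \<eta> < (1::real)"
    by (auto simp: eventually_at_right_field intro!: exI[of _ 1])
  have "(\<integral>t. g t \<partial>\<mu> x) \<le> (norm y)\<^sup>2"
    by (rule tendsto_lowerbound[OF lim]) (use small total(1) in \<open>auto elim: eventually_mono\<close>)
  moreover have "(norm y)\<^sup>2 \<le> (\<integral>t. g t \<partial>\<mu> x)"
    by (rule tendsto_lowerbound[OF lim]) (use small total(2) in \<open>auto elim: eventually_mono\<close>)
  ultimately show ?thesis by (simp add: g_def x_def)
qed

text \<open>
  A vector \<open>x\<close> in the range of a cell projection is approximately \<open>(T - z) y\<close> with
  \<open>y = x / (a - z)\<close>.  With cells of length \<open>\<bar>Im z\<bar> / 2\<close> the remainder lies in the same range and is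
  at most half as long, so iteration puts \<open>x\<close> into the closure; every vector is the sum of its cell components.
\<close>

lemma range_dense:
  assumes z: "Im z \<noteq> 0"
  shows "X \<subseteq> closure ((\<lambda>y. T y - z *\<^sub>C y) ` D)"
proof
  fix v assume v: "v \<in> X"
  define R where "R y = T y - z *\<^sub>C y" for y
  define \<epsilon> where "\<epsilon> = \<bar>Im z\<bar>"
  have \<epsilon>: "\<epsilon> > 0" using z by (simp add: \<epsilon>_def)
  have R_add: "R (y + w) = R y + R w" if "y \<in> D" "w \<in> D" for y w
    using that by (simp add: R_def T_add scaleC_add_right)
  have R_scale: "R (c *\<^sub>R y) = c *\<^sub>R R y" if "y \<in> D" for c y
  proof -
    have "z *\<^sub>C c *\<^sub>R y = c *\<^sub>R z *\<^sub>C y"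
      by (simp add: scaleC_scaleC mult.commute flip: scaleC_of_real)
    then show ?thesis using that by (simp add: R_def T_scaleR scaleR_diff_right)
  qed
  have sub: "subspace (R ` D)"
    unfolding subspace_def
  proof (intro conjI ballI allI)
    show "0 \<in> R ` D"
      using R_scale[of 0 0] by (intro image_eqI[of _ _ 0]) auto
    show "x + y \<in> R ` D" if "x \<in> R ` D" "y \<in> R ` D" for x y
      using that by (auto simp flip: R_add)
    show "c *\<^sub>R x \<in> R ` D" if "x \<in> R ` D" for c x
      using that by (auto simp flip: R_scale)
  qed
  have cells: "x \<in> closure (R ` D)" if x: "x \<in> X" "E C x = x" and C: "C = grid_cell (\<epsilon> / 2) n" for x C n
  proof -
    have Cb: "C \<in> sets borel" using C by simp
    obtain a where a: "C \<subseteq> {a - \<epsilon>/2..a + \<epsilon>/2}"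
      using grid_cell_subset[of "\<epsilon> / 2" n] \<epsilon> C by auto
    define s where "s = complex_of_real a - z"
    have s: "\<epsilon> \<le> cmod s"
      using abs_Im_le_cmod[of s] by (simp add: s_def \<epsilon>_def)
    \<comment> \<open>The remainder must stay in the range of the cell projection for the next step to apply.\<close>
    have "\<exists>y\<in>D. E C (x - R y) = x - R y \<and> norm (x - R y) \<le> norm x / 2 ^ k" for k
    proof (induction k)
      case 0
      show ?case using x R_scale[of 0 0] by (intro bexI[of _ 0]) auto
    next
      case (Suc k)
      then obtain y where y: "y \<in> D" "E C (x - R y) = x - R y" "norm (x - R y) \<le> norm x / 2 ^ k"
        by auto
      define u where "u = x - R y"
      define w where "w = inverse s *\<^sub>C u"
      have u: "u \<in> X" "E C u = u" using x y by (auto simp: u_def R_def intro: T_minus_in)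
      have w: "w \<in> X" "E C w = w" using u Cb by (auto simp: w_def E_scaleC)
      note wT = norm_T_le[OF w Cb a]
      have "s *\<^sub>C w = u"
      proof -
        have "s \<noteq> 0" using s \<epsilon> by auto
        then show ?thesis using scaleC_of_real[of 1 u] by (simp add: w_def scaleC_scaleC)
      qed
      moreover have "s *\<^sub>C w = a *\<^sub>R w - z *\<^sub>C w"
        using scaleC_add_left[of s z w] by (simp add: s_def scaleC_of_real)
      ultimately have res: "x - R (y + w) = - (T w - a *\<^sub>R w)"
        using y(1) wT(1) by (simp add: R_add) (simp add: R_def u_def algebra_simps)
      have "norm (x - R (y + w)) \<le> \<epsilon> / 2 * norm w"
        unfolding res norm_minus_cancel by (rule wT(2))
      also have "norm w = norm u / cmod s"
        by (simp add: w_def norm_scaleC norm_inverse divide_inverse mult.commute)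
      also have "\<epsilon> / 2 * (norm u / cmod s) \<le> norm u / 2"
      proof -
        have "\<epsilon> * (norm u / cmod s) \<le> cmod s * (norm u / cmod s)"
          using s \<epsilon> by (intro mult_right_mono) auto
        moreover have "s \<noteq> 0" using s \<epsilon> by auto
        ultimately have "\<epsilon> * (norm u / cmod s) \<le> norm u" by simp
        then show ?thesis by linarith
      qed
      also have "\<dots> \<le> norm x / 2 ^ Suc k"
        using y(3) by (simp add: u_def)
      finally have "norm (x - R (y + w)) \<le> norm x / 2 ^ Suc k" .
      moreover have "E C (x - R (y + w)) = x - R (y + w)"
      proof -
        have "E C (T w - a *\<^sub>R w) = T w - a *\<^sub>R w"
          using w wT(1) Cb by (simp add: E_diff E_scaleR T_commutes T_in)
        moreover have "E C (- (T w - a *\<^sub>R w)) = - E C (T w - a *\<^sub>R w)"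
          using E_scaleR[OF Cb, of "T w - a *\<^sub>R w" "-1"] w wT(1) by (simp add: T_in)
        ultimately show ?thesis unfolding res by simp
      qed
      ultimately show ?case using y(1) wT(1) by blast
    qed
    then have "\<exists>y. \<forall>k. y k \<in> D \<and> norm (x - R (y k)) \<le> norm x / 2 ^ k"
      by (intro choice) blast
    then obtain y where y: "\<And>k. y k \<in> D" "\<And>k. norm (x - R (y k)) \<le> norm x / 2 ^ k"
      by blast
    have "(\<lambda>k. x - R (y k)) \<longlonglongrightarrow> 0"
    proof (rule Lim_null_comparison)
      show "(\<lambda>k. norm x / 2 ^ k) \<longlonglongrightarrow> 0"
        by (rule LIMSEQ_divide_realpow_zero) simp
    qed (use y(2) in auto)
    from tendsto_diff[OF tendsto_const[of x] this] have "(\<lambda>k. R (y k)) \<longlonglongrightarrow> x" by simp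
    then show ?thesis
      using y(1) unfolding closure_sequential by (intro exI[of _ "\<lambda>k. R (y k)"]) auto
  qed
  have "(\<lambda>n. E (grid_cell (\<epsilon> / 2) n) v) sums v"
    using E_sums[OF image_subsetI[OF grid_cell_measurable] disjoint_grid_cells v, of "\<epsilon> / 2"] v
    by (simp add: Union_grid_cells E_UNIV)
  then have lim: "(\<lambda>n. \<Sum>i<n. E (grid_cell (\<epsilon> / 2) i) v) \<longlonglongrightarrow> v" by (simp add: sums_def)
  have "E (grid_cell (\<epsilon> / 2) i) v \<in> closure (R ` D)" for i
    by (rule cells[OF _ _ refl[of "grid_cell (\<epsilon> / 2) i"]]) (use v in \<open>auto simp: E_idem\<close>)
  then have "(\<Sum>i<n. E (grid_cell (\<epsilon> / 2) i) v) \<in> closure (R ` D)" for n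
    by (intro subspace_sum[OF subspace_closure[OF sub]])
  from closed_sequentially[OF closed_closure this lim]
  show "v \<in> closure ((\<lambda>y. T y - z *\<^sub>C y) ` D)" by (simp add: R_def[abs_def])
qed

lemma range_core_dense:
  assumes z: "Im z \<noteq> 0" and core: "is_core D T S"
  shows "X \<subseteq> closure ((\<lambda>y. T y - z *\<^sub>C y) ` S)"
proof -
  have "(\<lambda>y. T y - z *\<^sub>C y) ` D \<subseteq> closure ((\<lambda>y. T y - z *\<^sub>C y) ` S)"
  proof (rule image_subsetI)
    fix y assume "y \<in> D"
    then obtain s where s: "\<And>m. s m \<in> S" "s \<longlonglongrightarrow> y" "(\<lambda>m. T (s m)) \<longlonglongrightarrow> T y"
      using core unfolding is_core_def by blast
    have "(\<lambda>m. T (s m) - z *\<^sub>C s m) \<longlonglongrightarrow> T y - z *\<^sub>C y"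
      using s by (intro tendsto_diff tendsto_scaleC)
    then show "T y - z *\<^sub>C y \<in> closure ((\<lambda>y. T y - z *\<^sub>C y) ` S)"
      using s(1) unfolding closure_sequential
      by (intro exI[of _ "\<lambda>m. T (s m) - z *\<^sub>C s m"]) auto
  qed
  then show ?thesis
    using range_dense[OF z] closure_minimal[OF _ closed_closure] by blast
qed

end

section \<open>Poisson integrals determine weak limits\<close>

text \<open>
  The Poisson kernel of the upper half-plane at height \<open>\<epsilon>\<close>, without its normalizing factor
  \<open>\<epsilon> / \<pi>\<close>.  It equals \<open>1 / \<bar>r - \<i> \<epsilon>\<bar>\<^sup>2\<close>, the weight that occurs for resolvents.
\<close>

definition poisson_kernel :: "real \<Rightarrow> real \<Rightarrow> real" where
  "poisson_kernel \<epsilon> r = 1 / (r\<^sup>2 + \<epsilon>\<^sup>2)"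

lemma poisson_kernel_measurable [measurable]: "poisson_kernel \<epsilon> \<in> borel_measurable borel"
  unfolding poisson_kernel_def by measurable

lemma poisson_kernel_nonneg [simp]: "0 \<le> poisson_kernel \<epsilon> r"
  by (simp add: poisson_kernel_def)

lemma poisson_kernel_scale:
  "\<epsilon> > 0 \<Longrightarrow> poisson_kernel \<epsilon> (\<epsilon> * r) = poisson_kernel 1 r / \<epsilon>\<^sup>2"
  unfolding poisson_kernel_def power_mult_distrib divide_divide_eq_left
  by (simp add: algebra_simps)

lemma poisson_kernel_1:
  "integrable lborel (poisson_kernel 1)" "(\<integral>r. poisson_kernel 1 r \<partial>lborel) = pi"
proof -
  have eq: "poisson_kernel 1 = (\<lambda>r. inverse (1 + r\<^sup>2))"
    by (auto simp: poisson_kernel_def inverse_eq_divide add.commute)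
  show "integrable lborel (poisson_kernel 1)"
    using integrable_inverse_1_plus_square by (simp add: eq set_integrable_def)
  show "(\<integral>r. poisson_kernel 1 r \<partial>lborel) = pi"
    using LBINT_inverse_1_plus_square
    by (simp add: eq interval_lebesgue_integral_def set_lebesgue_integral_def)
qed

lemma integrable_poisson_kernel:
  assumes "\<epsilon> > 0"
  shows "integrable lborel (\<lambda>s. poisson_kernel \<epsilon> (t - s))"
proof -
  have "integrable lborel (\<lambda>s. poisson_kernel 1 (t / \<epsilon> + (- 1 / \<epsilon>) * s) / \<epsilon>\<^sup>2)"
    using lborel_integrable_real_affine[OF poisson_kernel_1(1), of "- 1 / \<epsilon>" "t / \<epsilon>"] assms by simp
  also have "(\<lambda>s. poisson_kernel 1 (t / \<epsilon> + (- 1 / \<epsilon>) * s) / \<epsilon>\<^sup>2) = (\<lambda>s. poisson_kernel \<epsilon> (t - s))"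
  proof
    fix s
    have "t - s = \<epsilon> * (t / \<epsilon> + (- 1 / \<epsilon>) * s)" using assms by (simp add: field_simps)
    then show "poisson_kernel 1 (t / \<epsilon> + (- 1 / \<epsilon>) * s) / \<epsilon>\<^sup>2 = poisson_kernel \<epsilon> (t - s)"
      using poisson_kernel_scale[OF assms] by metis
  qed
  finally show ?thesis .
qed

definition poisson_fourier :: "real \<Rightarrow> real \<Rightarrow> complex" where
  "poisson_fourier \<epsilon> \<sigma> = (\<integral>r. iexp (\<sigma> * r) * complex_of_real (poisson_kernel \<epsilon> r) \<partial>lborel)"

lemma poisson_fourier_scale:
  assumes "\<epsilon> > 0" shows "poisson_fourier \<epsilon> \<sigma> = poisson_fourier 1 (\<sigma> * \<epsilon>) / complex_of_real \<epsilon>"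
proof -
  have "poisson_fourier \<epsilon> \<sigma> = \<epsilon> *\<^sub>R (\<integral>r. iexp (\<sigma> * (0 + \<epsilon> * r)) * complex_of_real (poisson_kernel \<epsilon> (0 + \<epsilon> * r)) \<partial>lborel)"
    unfolding poisson_fourier_def using assms
    by (subst lborel_integral_real_affine[where c = \<epsilon> and t = 0]) auto
  also have "\<dots> = \<epsilon> *\<^sub>R (\<integral>r. iexp ((\<sigma> * \<epsilon>) * r) * complex_of_real (poisson_kernel 1 r) / complex_of_real (\<epsilon>\<^sup>2) \<partial>lborel)"
    using assms by (simp add: poisson_kernel_scale mult.assoc)
  also have "\<dots> = poisson_fourier 1 (\<sigma> * \<epsilon>) / complex_of_real \<epsilon>"
    using assms by (simp add: poisson_fourier_def scaleR_conv_of_real power2_eq_square)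
  finally show ?thesis .
qed

text \<open>
  The transform is \<open>(\<pi> / \<epsilon>) exp (- \<epsilon> \<bar>\<sigma>\<bar>)\<close>, but only its non-vanishing for one \<open>\<epsilon>\<close> matters for a
  division.  By scaling, this follows from continuity at \<open>0\<close> of the transform at height \<open>1\<close>, whose
  value there is \<open>\<pi>\<close>.
\<close>

lemma poisson_fourier_nonzero: "\<exists>\<epsilon>>0. poisson_fourier \<epsilon> \<sigma> \<noteq> 0"
proof -
  have "(\<lambda>n. poisson_fourier 1 (\<sigma> * inverse (real (Suc n)))) \<longlonglongrightarrow> poisson_fourier 1 0"
    unfolding poisson_fourier_def
  proof (rule integral_dominated_convergence[where w = "poisson_kernel 1"])
    have "(\<lambda>n. iexp (\<sigma> * inverse (real (Suc n)) * r)) \<longlonglongrightarrow> iexp (\<sigma> * 0 * r)" for r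
      by (intro isCont_tendsto_compose[OF isCont_iexp] tendsto_intros LIMSEQ_inverse_real_of_nat)
    then show "AE r in lborel. (\<lambda>n. iexp (\<sigma> * inverse (real (Suc n)) * r) * complex_of_real (poisson_kernel 1 r))
        \<longlonglongrightarrow> iexp (0 * r) * complex_of_real (poisson_kernel 1 r)"
      by (intro AE_I2 tendsto_mult tendsto_const) simp
  qed (auto simp: poisson_kernel_1 norm_mult)
  moreover have "poisson_fourier 1 0 \<noteq> 0"
    by (simp add: poisson_fourier_def poisson_kernel_1)
  ultimately have "\<forall>\<^sub>F n in sequentially. poisson_fourier 1 (\<sigma> * inverse (real (Suc n))) \<noteq> 0"
    by (rule tendsto_imp_eventually_ne)
  then obtain n where n: "poisson_fourier 1 (\<sigma> * inverse (real (Suc n))) \<noteq> 0"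
    using eventually_happens'[OF sequentially_bot] by blast
  have "inverse (real (Suc n)) > 0" by simp
  then show ?thesis using n poisson_fourier_scale by (metis divide_eq_0_iff of_real_eq_0_iff less_numeral_extra(3))
qed

lemma poisson_fourier_shift:
  "(\<integral>s. iexp (\<sigma> * s) * complex_of_real (poisson_kernel \<epsilon> (t - s)) \<partial>lborel) = iexp (\<sigma> * t) * poisson_fourier \<epsilon> \<sigma>"
proof -
  have "(\<integral>s. iexp (\<sigma> * s) * complex_of_real (poisson_kernel \<epsilon> (t - s)) \<partial>lborel)
      = (\<integral>r. iexp (\<sigma> * t) * (iexp (\<sigma> * r) * complex_of_real (poisson_kernel \<epsilon> r)) \<partial>lborel)"
    by (subst lborel_integral_real_affine[where c = 1 and t = t])
       (auto simp: poisson_kernel_def distrib_left exp_add mult.assoc)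
  then show ?thesis by (simp add: poisson_fourier_def)
qed

lemma integrable_iexp_mult:
  fixes g :: "real \<Rightarrow> real"
  assumes g: "integrable lborel g"
  shows "integrable lborel (\<lambda>s. iexp (\<sigma> * s) * complex_of_real (g s))"
proof (rule Bochner_Integration.integrable_bound[OF g])
  have "g \<in> borel_measurable borel" using borel_measurable_integrable[OF g] by simp
  then show "(\<lambda>s. iexp (\<sigma> * s) * complex_of_real (g s)) \<in> borel_measurable lborel" by simp
qed (simp add: norm_mult)

definition poisson_integral :: "real \<Rightarrow> real measure \<Rightarrow> real \<Rightarrow> real" where
  "poisson_integral \<epsilon> N s = (\<integral>t. poisson_kernel \<epsilon> (t - s) \<partial>N)"

lemma poisson_integral_nonneg [simp]: "0 \<le> poisson_integral \<epsilon> N s"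
  unfolding poisson_integral_def by (intro integral_nonneg_AE) auto

text \<open>
  The Fourier transform turns the convolution with the kernel into a product.
\<close>

lemma poisson_integral_fourier:
  assumes N: "finite_measure N" "sets N = sets borel" and \<epsilon>: "\<epsilon> > 0"
  shows "integrable lborel (poisson_integral \<epsilon> N)"
    and "(\<integral>s. iexp (\<sigma> * s) * complex_of_real (poisson_integral \<epsilon> N s) \<partial>lborel)
      = poisson_fourier \<epsilon> \<sigma> * (\<integral>t. iexp (\<sigma> * t) \<partial>N)"
proof -
  interpret finite_measure N by fact
  interpret pair_sigma_finite N lborel ..
  note [measurable_cong] = N(2)
  have J: "(\<integral>s. poisson_kernel \<epsilon> (t - s) \<partial>lborel) = (\<integral>s. poisson_kernel \<epsilon> (0 - s) \<partial>lborel)" for t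
    by (subst lborel_integral_real_affine[where c = 1 and t = t]) (auto simp: poisson_kernel_def)
  have pair: "integrable (N \<Otimes>\<^sub>M lborel) (\<lambda>(t, s). poisson_kernel \<epsilon> (t - s))"
  proof (rule Fubini_integrable)
    show "integrable N (\<lambda>t. \<integral>s. norm (case (t, s) of (t, s) \<Rightarrow> poisson_kernel \<epsilon> (t - s)) \<partial>lborel)"
      by (simp add: J)
  qed (auto intro: integrable_poisson_kernel[OF \<epsilon>])
  from integrable_snd[OF this] show "integrable lborel (poisson_integral \<epsilon> N)"
    by (simp add: poisson_integral_def[abs_def])
  have "integrable (N \<Otimes>\<^sub>M lborel) (\<lambda>(t, s). iexp (\<sigma> * s) * complex_of_real (poisson_kernel \<epsilon> (t - s)))"
    by (rule Bochner_Integration.integrable_bound[OF pair]) (auto simp: norm_mult)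
  note Fubini_integral[OF this]
  also have "(\<integral>t. (\<integral>s. iexp (\<sigma> * s) * complex_of_real (poisson_kernel \<epsilon> (t - s)) \<partial>lborel) \<partial>N)
      = poisson_fourier \<epsilon> \<sigma> * (\<integral>t. iexp (\<sigma> * t) \<partial>N)"
    by (simp only: poisson_fourier_shift integral_mult_left_zero mult.commute[of "poisson_fourier \<epsilon> \<sigma>"])
  finally show "(\<integral>s. iexp (\<sigma> * s) * complex_of_real (poisson_integral \<epsilon> N s) \<partial>lborel)
      = poisson_fourier \<epsilon> \<sigma> * (\<integral>t. iexp (\<sigma> * t) \<partial>N)"
    by (simp add: poisson_integral_def)
qed

text \<open>
  The Poisson integrals are nonnegative densities whose total integrals are the masses times a
  constant, so Scheffe's lemma upgrades their pointwise convergence to convergence in \<open>L\<^sup>1\<close>.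
\<close>

lemma tendsto_fourier_if_tendsto_poisson:
  fixes M :: "nat \<Rightarrow> real measure" and M' :: "real measure"
  assumes M: "\<And>n. finite_measure (M n)" "\<And>n. sets (M n) = sets borel"
    and M': "finite_measure M'" "sets M' = sets borel"
    and poisson: "\<And>\<epsilon> s. \<epsilon> > 0 \<Longrightarrow> (\<lambda>n. poisson_integral \<epsilon> (M n) s) \<longlonglongrightarrow> poisson_integral \<epsilon> M' s"
    and mass: "(\<lambda>n. measure (M n) UNIV) \<longlonglongrightarrow> measure M' UNIV"
  shows "(\<lambda>n. \<integral>t. iexp (\<sigma> * t) \<partial>M n) \<longlonglongrightarrow> (\<integral>t. iexp (\<sigma> * t) \<partial>M')"
proof -
  obtain \<epsilon> where \<epsilon>: "\<epsilon> > 0" "poisson_fourier \<epsilon> \<sigma> \<noteq> 0"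
    using poisson_fourier_nonzero by blast
  note h = poisson_integral_fourier[OF _ _ \<epsilon>(1)]
  \<comment> \<open>The case \<open>\<sigma> = 0\<close> of the product formula computes the total integral.\<close>
  have total: "(\<integral>\<^sup>+s. norm (poisson_integral \<epsilon> N s) \<partial>lborel)
      = ennreal (Re (poisson_fourier \<epsilon> 0) * measure N UNIV)"
    if N: "finite_measure N" "sets N = sets borel" for N
  proof -
    have "space N = UNIV" using sets_eq_imp_space_eq[OF N(2)] by simp
    then have "complex_of_real (\<integral>s. poisson_integral \<epsilon> N s \<partial>lborel) = poisson_fourier \<epsilon> 0 * measure N UNIV"
      using h(2)[OF N, of 0] by (simp add: scaleR_conv_of_real mult.commute)
    from arg_cong[OF this, of Re] h(1)[OF N] show ?thesis
      by (simp add: nn_integral_eq_integral)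
  qed
  have scheffe: "(\<lambda>n. \<integral>\<^sup>+s. norm (poisson_integral \<epsilon> (M n) s - poisson_integral \<epsilon> M' s) \<partial>lborel) \<longlonglongrightarrow> 0"
  proof (rule Scheffe_lemma1)
    have "(\<lambda>n. \<integral>\<^sup>+s. norm (poisson_integral \<epsilon> (M n) s) \<partial>lborel)
        \<longlonglongrightarrow> (\<integral>\<^sup>+s. norm (poisson_integral \<epsilon> M' s) \<partial>lborel)"
      unfolding total[OF M] total[OF M'] using mass by (intro tendsto_ennrealI tendsto_intros)
    from lim_imp_Limsup[OF _ this]
    show "limsup (\<lambda>n. \<integral>\<^sup>+s. norm (poisson_integral \<epsilon> (M n) s) \<partial>lborel)
        \<le> (\<integral>\<^sup>+s. norm (poisson_integral \<epsilon> M' s) \<partial>lborel)" by simp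
  qed (use h(1) M M' poisson[OF \<epsilon>(1)] in auto)
  note int = integrable_iexp_mult[OF h(1)]
  have "(\<lambda>n. \<integral>s. iexp (\<sigma> * s) * complex_of_real (poisson_integral \<epsilon> (M n) s) \<partial>lborel)
      \<longlonglongrightarrow> (\<integral>s. iexp (\<sigma> * s) * complex_of_real (poisson_integral \<epsilon> M' s) \<partial>lborel)"
  proof (rule tendsto_L1_int[OF int[OF M] int[OF M']])
    have "norm (iexp (\<sigma> * s) * complex_of_real a - iexp (\<sigma> * s) * complex_of_real b) = norm (a - b)" for s a b
      by (simp add: norm_mult flip: right_diff_distrib of_real_diff)
    then show "(\<lambda>n. \<integral>\<^sup>+s. norm (iexp (\<sigma> * s) * complex_of_real (poisson_integral \<epsilon> (M n) s)
        - iexp (\<sigma> * s) * complex_of_real (poisson_integral \<epsilon> M' s)) \<partial>lborel) \<longlonglongrightarrow> 0"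
      using scheffe by simp
  qed
  then have "(\<lambda>n. poisson_fourier \<epsilon> \<sigma> * (\<integral>t. iexp (\<sigma> * t) \<partial>M n)) \<longlonglongrightarrow> poisson_fourier \<epsilon> \<sigma> * (\<integral>t. iexp (\<sigma> * t) \<partial>M')"
    by (simp only: h(2)[OF M] h(2)[OF M'])
  from tendsto_divide[OF this tendsto_const \<epsilon>(2)] \<epsilon>(2) show ?thesis by simp
qed

text \<open>
  Levy's continuity theorem concerns probability measures; here the masses vary.  Dividing by them
  reduces to that case unless the limit is the zero measure, where convergence of the masses
  suffices.
\<close>

lemma finite_measure_levy_continuity:
  fixes M :: "nat \<Rightarrow> real measure" and M' :: "real measure"
    and f :: "real \<Rightarrow> 'b::{banach, second_countable_topology}"
  assumes M: "\<And>n. finite_measure (M n)" "\<And>n. sets (M n) = sets borel"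
    and M': "finite_measure M'" "sets M' = sets borel"
    and fourier: "\<And>\<sigma>. (\<lambda>n. \<integral>t. iexp (\<sigma> * t) \<partial>M n) \<longlonglongrightarrow> (\<integral>t. iexp (\<sigma> * t) \<partial>M')"
    and f: "continuous_on UNIV f" "\<And>t. norm (f t) \<le> B"
  shows "(\<lambda>n. \<integral>t. f t \<partial>M n) \<longlonglongrightarrow> (\<integral>t. f t \<partial>M')"
proof -
  have space: "space N = UNIV" if "sets N = sets borel" for N :: "real measure"
    using sets_eq_imp_space_eq[OF that] by simp
  note spaces = space[OF M(2)] space[OF M'(2)]
  have f_meas: "f \<in> borel_measurable N" if "sets N = sets borel" for N
    using borel_measurable_continuous_onI[OF f(1)] that by (simp cong: measurable_cong_sets)
  define m where "m n = measure (M n) UNIV" for n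
  define m' where "m' = measure M' UNIV"
  have "(\<lambda>n. complex_of_real (m n)) \<longlonglongrightarrow> complex_of_real m'"
    using fourier[of 0] by (simp add: m_def m'_def spaces scaleR_conv_of_real)
  then have mass: "m \<longlonglongrightarrow> m'" by (simp add: tendsto_of_real_iff)
  have bound: "norm (\<integral>t. f t \<partial>N) \<le> B * measure N UNIV"
    if N: "finite_measure N" "sets N = sets borel" for N
  proof -
    interpret finite_measure N by fact
    have int: "integrable N f" using f f_meas[OF N(2)] by (intro integrable_const_bound) auto
    have "norm (\<integral>t. f t \<partial>N) \<le> (\<integral>t. norm (f t) \<partial>N)" by (rule integral_norm_bound)
    also have "\<dots> \<le> (\<integral>t. B \<partial>N)" using int f by (intro integral_mono) auto
    finally show ?thesis by (simp add: space[OF N(2)] mult.commute)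
  qed
  show ?thesis
  proof (cases "m' = 0")
    case True
    then have "(\<integral>t. f t \<partial>M') = 0" using bound[OF M'] by (simp add: m'_def)
    moreover have "(\<lambda>n. \<integral>t. f t \<partial>M n) \<longlonglongrightarrow> 0"
    proof (rule Lim_null_comparison)
      show "(\<lambda>n. B * m n) \<longlonglongrightarrow> 0" using mass True by (auto intro: tendsto_mult_right_zero)
    qed (use bound[OF M] in \<open>auto simp: m_def\<close>)
    ultimately show ?thesis by simp
  next
    case False
    then have m'_pos: "m' > 0" by (simp add: m'_def zero_less_measure_iff less_le)
    have m_pos: "\<forall>\<^sub>F n in sequentially. m n > 0" using order_tendstoD(1)[OF mass m'_pos] .
    \<comment> \<open>Finitely many of the measures may vanish; the Dirac measure stands in for their
      normalization.\<close>
    define R where "R N = (if measure N UNIV > 0 then density N (\<lambda>_. ennreal (1 / measure N UNIV))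
        else return borel 0)" for N :: "real measure"
    have distr: "real_distribution (R N)" if N: "finite_measure N" "sets N = sets borel" for N
    proof -
      interpret finite_measure N by fact
      have "emeasure (R N) (space (R N)) = 1"
        by (simp add: R_def emeasure_density N(2) space[OF N(2)] emeasure_eq_measure nn_integral_cmult_indicator
            flip: ennreal_mult')
      then show ?thesis
        using N space[OF N(2)]
        by (auto simp: real_distribution_def real_distribution_axioms_def R_def intro: prob_spaceI)
    qed
    have integral_R: "(\<integral>t. g t \<partial>R N) = (1 / measure N UNIV) *\<^sub>R (\<integral>t. g t \<partial>N)"
      if "measure N UNIV > 0" "g \<in> borel_measurable N" for N and g :: "real \<Rightarrow> 'c::{banach, second_countable_topology}"
      using that by (simp add: R_def integral_density)
    have R_lim: "(\<lambda>n. \<integral>t. g t \<partial>R (M n)) \<longlonglongrightarrow> (\<integral>t. g t \<partial>R M')"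
      if lim: "(\<lambda>n. \<integral>t. g t \<partial>M n) \<longlonglongrightarrow> (\<integral>t. g t \<partial>M')" and g: "g \<in> borel_measurable borel"
      for g :: "real \<Rightarrow> complex"
    proof -
      have g': "g \<in> borel_measurable N" if "sets N = sets borel" for N
        using g that by (simp cong: measurable_cong_sets)
      have "(\<lambda>n. (1 / m n) *\<^sub>R (\<integral>t. g t \<partial>M n)) \<longlonglongrightarrow> (1 / m') *\<^sub>R (\<integral>t. g t \<partial>M')"
        using mass m'_pos lim by (intro tendsto_intros) auto
      then have "(\<lambda>n. \<integral>t. g t \<partial>R (M n)) \<longlonglongrightarrow> (1 / m') *\<^sub>R (\<integral>t. g t \<partial>M')"
        by (rule Lim_transform_eventually)
           (use m_pos g' M in \<open>auto simp: m_def integral_R elim!: eventually_mono\<close>)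
      then show ?thesis using m'_pos g' M' by (simp add: integral_R m'_def)
    qed
    interpret R': real_distribution "R M'" using distr[OF M'] .
    have "weak_conv_m (\<lambda>n. R (M n)) (R M')"
      by (rule levy_continuity[OF distr[OF M] distr[OF M']]) (unfold char_def, rule R_lim[OF fourier], measurable)
    then have "(\<lambda>n. \<integral>t. f t \<partial>R (M n)) \<longlonglongrightarrow> (\<integral>t. f t \<partial>R M')"
      using f by (intro weak_conv_imp_integral_bdd_continuous_conv[OF distr[OF M] distr[OF M']])
        (auto simp: continuous_on_eq_continuous_at)
    then have "(\<lambda>n. m n *\<^sub>R (\<integral>t. f t \<partial>R (M n))) \<longlonglongrightarrow> m' *\<^sub>R (\<integral>t. f t \<partial>R M')"
      using mass by (intro tendsto_intros)
    then have "(\<lambda>n. \<integral>t. f t \<partial>M n) \<longlonglongrightarrow> m' *\<^sub>R (\<integral>t. f t \<partial>R M')"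
      by (rule Lim_transform_eventually)
         (use m_pos f_meas M in \<open>auto simp: m_def integral_R elim!: eventually_mono\<close>)
    then show ?thesis using m'_pos f_meas M' by (simp add: integral_R m'_def)
  qed
qed

section \<open>Convergence of the spectral measures of compressions\<close>

text \<open>
  For \<open>v = (L - z) u\<close> with \<open>u\<close> in the core, both integrals are squared norms once \<open>P\<^sub>n v\<close> is replaced by
  \<open>(L\<^sub>n - z) P\<^sub>n u\<close>.  The vectors \<open>(L - z) u\<close> are dense, and the error of replacing a general \<open>v\<close> by one of them is
  controlled uniformly in \<open>n\<close>.
\<close>

lemma tendsto_poisson_compression:
  fixes L :: "'a::chilbert_space \<Rightarrow> 'a" and D S :: "'a set"
    and V :: "nat \<Rightarrow> 'a set" and P :: "nat \<Rightarrow> 'a \<Rightarrow> 'a"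
  assumes L: "spectral_operator UNIV E D L"
    and P: "\<And>n. orthogonal_projection UNIV (V n) (P n)"
    and compress: "\<And>n. spectral_operator (V n) (En n) (V n) (compression (P n) L)"
    and strong: "\<And>u. (\<lambda>n. P n u) \<longlonglongrightarrow> u"
    and core: "is_core D L S" "\<And>u. u \<in> S \<Longrightarrow> (\<lambda>n. L (P n u)) \<longlonglongrightarrow> L u"
    and z: "Im z \<noteq> 0"
  shows "(\<lambda>n. \<integral>t. 1 / (cmod (complex_of_real t - z))\<^sup>2 \<partial>scalar_spectral_measure (En n) (P n v))
    \<longlonglongrightarrow> (\<integral>t. 1 / (cmod (complex_of_real t - z))\<^sup>2 \<partial>scalar_spectral_measure E v)"
    (is "(\<lambda>n. ?J (?\<mu>n n (P n v))) \<longlonglongrightarrow> ?J (?\<mu> v)")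
proof (rule tendstoI)
  fix e :: real assume e: "e > 0"
  note L_res = spectral_operator.axioms(1)[OF L] and C_res = spectral_operator.axioms(1)[OF compress]
  note UNIV_closed = spectral_resolution.X[OF L_res]
  note P_facts = projection_in(1)[OF UNIV_closed P] projection_diff[OF UNIV_closed P]
    norm_projection_le[OF UNIV_closed P]
  have P_lim: "(\<lambda>n. P n (w n)) \<longlonglongrightarrow> w'" if w: "w \<longlonglongrightarrow> w'" for w w'
  proof -
    have "(\<lambda>n. P n (w n - w')) \<longlonglongrightarrow> 0"
    proof (rule Lim_null_comparison)
      show "\<forall>\<^sub>F n in sequentially. norm (P n (w n - w')) \<le> norm (w n - w')"
        using P_facts(3) by simp
      show "(\<lambda>n. norm (w n - w')) \<longlonglongrightarrow> 0" using w by (simp add: LIM_zero tendsto_norm_zero)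
    qed
    from tendsto_add[OF this strong[of w']] show ?thesis by (simp add: P_facts(2))
  qed
  define M where "M = 1 / \<bar>Im z\<bar>\<^sup>2"
  define K where "K x w = M * norm (x - w) * ((norm x)\<^sup>2 + (norm w)\<^sup>2 + norm (x - w) + 1)" for x w :: 'a
  have K_lim: "(\<lambda>n. K (x n) (w n)) \<longlonglongrightarrow> K x' w'" if "x \<longlonglongrightarrow> x'" "w \<longlonglongrightarrow> w'" for x w x' w'
    unfolding K_def using that by (intro tendsto_intros)
  have K_commute: "K x w = K w x" for x w
    by (simp add: K_def norm_minus_commute add.commute)
  have far: "\<bar>Im z\<bar> \<le> cmod (complex_of_real t - z)" for t
    using abs_Im_le_cmod[of "complex_of_real t - z"] by simp
  have "0 < \<bar>Im z\<bar>\<^sup>2" using z by simp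
  then have g: "0 \<le> 1 / (cmod (complex_of_real t - z))\<^sup>2" "1 / (cmod (complex_of_real t - z))\<^sup>2 \<le> M" for t
    using frac_le[OF _ order_refl _ power_mono[OF far], of 1 2 t] by (auto simp: M_def)
  have meas: "(\<lambda>t. 1 / (cmod (complex_of_real t - z))\<^sup>2) \<in> borel_measurable borel"
    by measurable
  have KL: "\<bar>?J (?\<mu> x) - ?J (?\<mu> w)\<bar> \<le> K x w" for x w
    unfolding K_def using spectral_resolution.integral_\<mu>_diff_le[OF L_res UNIV_I UNIV_I meas g] by blast
  have KC: "\<bar>?J (?\<mu>n n x) - ?J (?\<mu>n n w)\<bar> \<le> K x w" if "x \<in> V n" "w \<in> V n" for n x w
    unfolding K_def using spectral_resolution.integral_\<mu>_diff_le[OF C_res that meas g] by blast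
  obtain x where x: "\<And>k. x k \<in> (\<lambda>y. L y - z *\<^sub>C y) ` S" "x \<longlonglongrightarrow> v"
    using subsetD[OF spectral_operator.range_core_dense[OF L z core(1)] UNIV_I, of v]
    unfolding closure_sequential by auto
  have "(\<lambda>k. K (x k) v) \<longlonglongrightarrow> K v v" using x(2) by (intro K_lim tendsto_const)
  then have "\<forall>\<^sub>F k in sequentially. K (x k) v < e / 3"
    by (rule order_tendstoD) (use e in \<open>simp add: K_def\<close>)
  then obtain k where k: "K (x k) v < e / 3"
    using eventually_happens'[OF sequentially_bot] by blast
  obtain u where u: "u \<in> S" "x k = L u - z *\<^sub>C u" using x(1) by blast
  have uD: "u \<in> D" using u(1) core(1) by (auto simp: is_core_def)
  \<comment> \<open>The resolvent of the compression takes \<open>y n\<close> to \<open>P n u\<close>, just as that of \<open>L\<close> takes \<open>x k\<close>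
    to \<open>u\<close>.\<close>
  define y where "y n = compression (P n) L (P n u) - z *\<^sub>C P n u" for n
  have y_lim: "y \<longlonglongrightarrow> x k"
    unfolding y_def u(2) compression_def
    by (intro tendsto_diff tendsto_scaleC P_lim core(2) u(1) strong)
  have yV: "y n \<in> V n" for n
    unfolding y_def by (rule spectral_operator.T_minus_in[OF compress]) (simp add: P_facts)
  have "(\<lambda>n. (norm (P n u))\<^sup>2) \<longlonglongrightarrow> (norm u)\<^sup>2"
    by (intro tendsto_intros strong)
  moreover have "?J (?\<mu>n n (y n)) = (norm (P n u))\<^sup>2" for n
    unfolding y_def by (rule spectral_operator.integral_poisson_resolvent[OF compress _ z]) (simp add: P_facts)
  moreover have "?J (?\<mu> (x k)) = (norm u)\<^sup>2"
    unfolding u(2) by (rule spectral_operator.integral_poisson_resolvent[OF L uD z])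
  ultimately have "(\<lambda>n. ?J (?\<mu>n n (y n))) \<longlonglongrightarrow> ?J (?\<mu> (x k))" by simp
  then have "\<forall>\<^sub>F n in sequentially. dist (?J (?\<mu>n n (y n))) (?J (?\<mu> (x k))) < e / 3"
    by (rule tendstoD) (use e in simp)
  moreover have "\<forall>\<^sub>F n in sequentially. K (P n v) (y n) < e / 3"
    using K_lim[OF strong y_lim] by (rule order_tendstoD) (use k in \<open>simp add: K_commute\<close>)
  ultimately show "\<forall>\<^sub>F n in sequentially. dist (?J (?\<mu>n n (P n v))) (?J (?\<mu> v)) < e"
  proof eventually_elim
    case (elim n)
    have "dist (?J (?\<mu>n n (P n v))) (?J (?\<mu>n n (y n))) < e / 3"
      unfolding dist_real_def by (rule le_less_trans[OF KC elim(2)]) (simp_all add: P_facts yV)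
    moreover have "dist (?J (?\<mu> (x k))) (?J (?\<mu> v)) < e / 3"
      unfolding dist_real_def by (rule le_less_trans[OF KL k])
    ultimately show ?case using dist_triangle_third[OF _ elim(1)] by blast
  qed
qed

theorem theorem4p5:
  fixes L :: "'a::chilbert_space \<Rightarrow> 'a" and D S :: "'a set"
    and V :: "nat \<Rightarrow> 'a set" and P :: "nat \<Rightarrow> 'a \<Rightarrow> 'a"
    and E :: "real set \<Rightarrow> 'a \<Rightarrow> 'a" and En :: "nat \<Rightarrow> real set \<Rightarrow> 'a \<Rightarrow> 'a"
    and v :: 'a and f :: "real \<Rightarrow> complex"
  assumes "self_adjoint_operator UNIV D L"
    and "\<And>n. orthogonal_projection UNIV (V n) (P n)"
    and "\<And>n. V n \<subseteq> D"
    and "\<And>u. (\<lambda>n. norm (P n u - u)) \<longlonglongrightarrow> 0"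
    and "is_core D L S"
    and "\<And>u. u \<in> S \<Longrightarrow> (\<lambda>n. L (P n u)) \<longlonglongrightarrow> L u"
    and "\<And>u. u \<in> S \<Longrightarrow> (\<lambda>n. P n u) \<longlonglongrightarrow> u"
    and "is_spectral_measure UNIV D L E"
    and "\<And>n. is_spectral_measure (V n) (V n) (compression (P n) L) (En n)"
    and "continuous_on UNIV f" and "bounded (range f)"
  shows "(\<lambda>n. \<integral>t. f t \<partial>scalar_spectral_measure (En n) (P n v))
           \<longlonglongrightarrow> (\<integral>t. f t \<partial>scalar_spectral_measure E v)"
proof -
  note L = assms(1) and P = assms(2) and VD = assms(3)
  have L_op: "spectral_operator UNIV E D L"
    using L assms(8)
    by (auto simp: spectral_operator_def spectral_resolution_def spectral_operator_axioms_def
        self_adjoint_operator_def is_spectral_measure_def)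
  have C_op: "spectral_operator (V n) (En n) (V n) (compression (P n) L)" for n
    using self_adjoint_compression[OF L P VD, of n] assms(9)[of n]
    by (auto simp: spectral_operator_def spectral_resolution_def spectral_operator_axioms_def
        self_adjoint_operator_def is_spectral_measure_def)
  note L_res = spectral_operator.axioms(1)[OF L_op] and C_res = spectral_operator.axioms(1)[OF C_op]
  have PV: "P n v \<in> V n" for n
    using projection_in(1)[OF spectral_resolution.X[OF L_res] P] by blast
  have strong: "(\<lambda>n. P n u) \<longlonglongrightarrow> u" for u
    using assms(4)[of u] by (rule LIM_zero_cancel[OF tendsto_norm_zero_cancel])
  obtain B where B: "\<And>t. norm (f t) \<le> B"
    using assms(11) by (auto simp: bounded_iff)
  have finite: "finite_measure (scalar_spectral_measure (En n) (P n v))"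
      "finite_measure (scalar_spectral_measure E v)" for n
    using spectral_resolution.finite_measure_\<mu>[OF C_res PV] spectral_resolution.finite_measure_\<mu>[OF L_res]
    by blast+
  show ?thesis
  proof (rule finite_measure_levy_continuity[OF _ _ _ _ tendsto_fourier_if_tendsto_poisson assms(10) B])
    fix \<epsilon> s :: real assume \<epsilon>: "\<epsilon> > 0"
    have kernel: "poisson_kernel \<epsilon> (t - s) = 1 / (cmod (complex_of_real t - Complex s \<epsilon>))\<^sup>2" for t
      by (simp add: poisson_kernel_def cmod_power2)
    show "(\<lambda>n. poisson_integral \<epsilon> (scalar_spectral_measure (En n) (P n v)) s)
        \<longlonglongrightarrow> poisson_integral \<epsilon> (scalar_spectral_measure E v) s"
      unfolding poisson_integral_def kernel
      by (rule tendsto_poisson_compression[OF L_op P C_op strong assms(5,6)]) (use \<epsilon> in auto)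
  next
    have "(\<lambda>n. (norm (P n v))\<^sup>2) \<longlonglongrightarrow> (norm v)\<^sup>2"
      by (intro tendsto_intros strong)
    then show "(\<lambda>n. measure (scalar_spectral_measure (En n) (P n v)) UNIV)
        \<longlonglongrightarrow> measure (scalar_spectral_measure E v) UNIV"
      by (simp add: spectral_resolution.measure_\<mu>_UNIV[OF C_res PV]
          spectral_resolution.measure_\<mu>_UNIV[OF L_res])
  qed (use finite in auto)
qed

end
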